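(* The groups $G(\alpha)$ and $G(\widetilde{\alpha})$ are isomorphic if and only if $\widetilde{\alpha} = \mathrm{ad}(h) \circ \beta \alpha \beta^{-1}$ for some group isomorphism $\beta: \Gamma \to \widetilde{\Gamma}$ and some $h \in \widetilde{\Gamma}$, where $\mathrm{ad}(h)$ denotes conjugation by $h$.
   Context: Let $\Gamma$ and $\widetilde{\Gamma}$ be groups, and let $\alpha \in \mathrm{Aut}(\Gamma)$ and $\widetilde{\alpha} \in \mathrm{Aut}(\widetilde{\Gamma})$ be automorphisms. Let $V$ be Richard Thompson's group $V$, acting on the Cantor space $\mathfrak{C} = \{0,1\}^{\mathbb{N}}$, and let $\mathbb{Q}_2 \subset \mathfrak{C}$ be the dyadic rationals, i.e. the infinite binary sequences that are eventually $0$. For $v \in V$ and $x \in \mathbb{Q}_2$, $v'(x)$ denotes the slope of $v$ at $x$ (a power of $2$). Define $G(\alpha) := K(\alpha) \rtimes V$, where $K(\alpha)$ is the group of maps $a: \{0,1\}^* \to \Gamma$ satisfying $a(u) = \alpha(a(u0))$ for all words $u \in \{0,1\}^*$, with $V$ acting by the Jones action associated to the group morphism $\Gamma^2 \to \Gamma, (g,h) \mapsto \alpha(g)$. Equivalently, $G(\alpha)$ is isomorphic to the unrestricted twisted permutational wreath product $\prod_{\mathbb{Q}_2} \Gamma \rtimes_\rho V$, where $\rho(v)(a)(x) = \alpha^{-\log_2(v'(v^{-1}x))}(a(v^{-1}x))$ for $a: \mathbb{Q}_2 \to \Gamma$, $v \in V$, $x \in \mathbb{Q}_2$. Define $G(\widetilde{\alpha})$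 analogously from $\widetilde{\Gamma}$ and $\widetilde{\alpha}$. *)

theory Defs
  imports "HOL-Algebra.Group" "HOL-Library.FuncSet"
begin

type_synonym cantor = "nat \<Rightarrow> bool"

definition pre :: "bool list \<Rightarrow> cantor \<Rightarrow> cantor" where
  "pre u x = (\<lambda>n. if n < length u then u ! n else x (n - length u))"

definition cone :: "bool list \<Rightarrow> cantor set" where
  "cone u = {x. \<forall>n < length u. x n = u ! n}"

definition complete_prefix_code :: "bool list list \<Rightarrow> bool" where
  "complete_prefix_code us \<longleftrightarrow> (\<forall>x. \<exists>!i. i < length us \<and> x \<in> cone (us ! i))"

definition thompsonV_set :: "(cantor \<Rightarrow> cantor) set" where
  "thompsonV_set = {f. \<exists>us ws. length us = length ws \<and> complete_prefix_code us \<and>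
       complete_prefix_code ws \<and>
       (\<forall>i < length us. \<forall>y. f (pre (us ! i) y) = pre (ws ! i) y)}"

definition thompsonV :: "(cantor \<Rightarrow> cantor) monoid" where
  "thompsonV = \<lparr>carrier = thompsonV_set, mult = (\<circ>), one = id\<rparr>"

definition dyadic :: "cantor set" where
  "dyadic = {x. \<exists>N. \<forall>n \<ge> N. \<not> x n}"

text \<open>log2 of the slope v'(x): near x, v acts as u y \<mapsto> w y, slope 2^(|u|-|w|).\<close>
definition log2_slope :: "(cantor \<Rightarrow> cantor) \<Rightarrow> cantor \<Rightarrow> int" where
  "log2_slope v x = (THE k. \<exists>u w. x \<in> cone u \<and> (\<forall>y. v (pre u y) = pre w y) \<and>
       k = int (length u) - int (length w))"

definition aut_pow :: "('g, 'm) monoid_scheme \<Rightarrow> ('g \<Rightarrow> 'g) \<Rightarrow> int \<Rightarrow> 'g \<Rightarrow> 'g" where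
  "aut_pow \<Gamma> \<alpha> n = (if 0 \<le> n then \<alpha> ^^ nat n else (inv_into (carrier \<Gamma>) \<alpha>) ^^ nat (- n))"

definition twist_action ::
  "('g, 'm) monoid_scheme \<Rightarrow> ('g \<Rightarrow> 'g) \<Rightarrow> (cantor \<Rightarrow> cantor) \<Rightarrow> (cantor \<Rightarrow> 'g) \<Rightarrow> (cantor \<Rightarrow> 'g)" where
  "twist_action \<Gamma> \<alpha> v a = (\<lambda>x \<in> dyadic.
      aut_pow \<Gamma> \<alpha> (- log2_slope v (inv_into UNIV v x)) (a (inv_into UNIV v x)))"

definition G_alpha ::
  "('g, 'm) monoid_scheme \<Rightarrow> ('g \<Rightarrow> 'g) \<Rightarrow> ((cantor \<Rightarrow> 'g) \<times> (cantor \<Rightarrow> cantor)) monoid" where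
  "G_alpha \<Gamma> \<alpha> = \<lparr>carrier = (dyadic \<rightarrow>\<^sub>E carrier \<Gamma>) \<times> carrier thompsonV,
     mult = (\<lambda>(a, v) (b, w). ((\<lambda>x \<in> dyadic. mult \<Gamma> (a x) (twist_action \<Gamma> \<alpha> v b x)), v \<circ> w)),
     one = ((\<lambda>x \<in> dyadic. one \<Gamma>), id)\<rparr>"

end

(* Conjugation lets G(alpha) act on K(alpha). Two halves of K supported on complementary cones
   commute, are exchanged by an element of V, and together are normal; a double commutator argument
   shows that every homomorphism of G(alpha) onto V kills such halves, so an isomorphism theta maps
   K onto K' and induces an automorphism psi of V.

   Rubin's theorem is avoided by working with K. If v, w in V have disjoint supports then
   [v, [w, K]] = 1; applied to a function on the other side supported at a single point y, this says
   that psi(v) preserves {y, psi(w) y}. Since swaps of cones factor into two conjugate swaps, psi(v)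
   and psi(swap) never both move y. An element supported at x is a commutator b v(b)^-1 with b and v
   supported near x (an infinite swindle along an orbit), and the values of theta(b) away from x are
   central; hence theta of it is trivial at every point moved by psi(swap) for a swap avoiding x.
   Double transitivity of V on the dyadic points then forces theta to carry the factor at x to the
   factor at some phi(x), with phi equivariant.

   Finally phi respects germs: trivial ones by disjointness of moved sets, and the sign of the slope
   because attracted orbits stay attracted. Comparing how the contraction at 0 acts on the factors at
   0 and phi(0) gives the conjugacy of alpha and alpha' up to an inner automorphism. *)
theory Submission
  imports Defs "HOL-Algebra.Product_Groups"
begin

text \<open>\<open>\<Gamma>\<close> is arbitrary, and this shapes the whole argument. It may itself
  map onto \<open>V\<close>, so nothing intrinsic to \<open>\<Gamma>\<close> can make
  \<open>K\<close> die in \<open>V\<close>. It may be abelian, so commutation inside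
  \<open>K\<close> cannot tell the factors apart, and supports have to be read off from which
  elements of \<open>V\<close> leave a function invariant. It may be trivial, and then
  \<open>K\<close> carries no information at all; that case is split off at the end. An isomorphism
  need not match the two copies of \<open>V\<close>: the image of \<open>v\<close> has a
  \<open>K\<close>-part, and its values are the source of the inner automorphism. Dyadic points
  suffice throughout because a finite word, hence an element of \<open>V\<close>, is determined by
  what it does there. The germs of \<open>V\<close> fixing a dyadic point form an infinite cyclic
  group via the slope, so preserving trivial germs determines the image of the contraction only up
  to sign. The wrong sign would replace \<open>\<alpha>\<close> by its inverse, which is why
  attraction and repulsion must be told apart.\<close>

section \<open>Words, cones and dyadic points\<close>

definition pfx :: "cantor \<Rightarrow> nat \<Rightarrow> bool list" where
  "pfx x n = map x [0..<n]"

definition tail :: "nat \<Rightarrow> cantor \<Rightarrow> cantor" where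
  "tail n x = (\<lambda>i. x (i + n))"

definition zeros :: cantor where
  "zeros = (\<lambda>_. False)"

abbreviation hinv :: "(cantor \<Rightarrow> cantor) \<Rightarrow> cantor \<Rightarrow> cantor" where
  "hinv f \<equiv> inv_into UNIV f"

lemma length_pfx [simp]: "length (pfx x n) = n"
  by (simp add: pfx_def)

lemma nth_pfx [simp]: "i < n \<Longrightarrow> pfx x n ! i = x i"
  by (simp add: pfx_def)

lemma cone_iff: "x \<in> cone u \<longleftrightarrow> pfx x (length u) = u"
  by (auto simp: cone_def list_eq_iff_nth_eq)

lemma pre_in_cone [simp]: "pre u y \<in> cone u"
  by (simp add: cone_def pre_def)

lemma in_cone_pfx [simp]: "x \<in> cone (pfx x n)"
  by (simp add: cone_iff)

lemma pre_tail: "x \<in> cone u \<Longrightarrow> pre u (tail (length u) x) = x"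
  by (auto simp: cone_def pre_def tail_def)

lemma pre_pfx_tail [simp]: "pre (pfx x n) (tail n x) = x"
  using pre_tail[of x "pfx x n"] by simp

lemma tail_pre [simp]: "tail (length u) (pre u y) = y"
  by (auto simp: pre_def tail_def)

lemma in_coneE:
  assumes "x \<in> cone u" obtains y where "x = pre u y"
  using pre_tail[OF assms] by metis

lemma pre_inj [simp]: "pre u y = pre u z \<longleftrightarrow> y = z"
  by (metis tail_pre)

lemma pre_append: "pre (u @ w) y = pre u (pre w y)"
  by (auto simp: pre_def nth_append)

lemma pfx_pre [simp]: "pfx (pre u y) (length u) = u"
  using cone_iff pre_in_cone by blast

lemma pfx_add: "pfx x (m + j) = pfx x m @ pfx (tail m x) j"
  by (auto simp: list_eq_iff_nth_eq nth_append tail_def)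

lemma pre_Nil [simp]: "pre [] x = x"
  by (simp add: pre_def)

lemma pre_in_cone_append [simp]: "pre u x \<in> cone (u @ w) \<longleftrightarrow> x \<in> cone w"
proof
  assume "pre u x \<in> cone (u @ w)"
  then obtain y where "pre u x = pre (u @ w) y" by (rule in_coneE)
  then show "x \<in> cone w" by (simp add: pre_append)
next
  assume "x \<in> cone w"
  then obtain y where "x = pre w y" by (rule in_coneE)
  then show "pre u x \<in> cone (u @ w)" using pre_in_cone[of "u @ w" y] by (simp add: pre_append)
qed

lemma pre_Cons_in_cone [simp]: "pre (a # u) x \<in> cone (b # w) \<longleftrightarrow> a = b \<and> pre u x \<in> cone w"
proof -
  have "pre (a # u) x n = (case n of 0 \<Rightarrow> a | Suc k \<Rightarrow> pre u x k)" for n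
    by (simp add: pre_def split: nat.split)
  then show ?thesis
    unfolding cone_def by (simp add: All_less_Suc2)
qed

lemma cone_Nil [simp]: "x \<in> cone []"
  by (simp add: cone_def)

lemma cone_append_subset: "cone (u @ w) \<subseteq> cone u"
  by (auto simp: cone_def nth_append)

lemma pfx_eq_disjoint:
  assumes "pfx x n \<noteq> pfx y n" shows "cone (pfx x n) \<inter> cone (pfx y n) = {}"
  using assms by (auto simp: cone_iff)

lemma pfx_neq_mono: "pfx x m \<noteq> pfx y m \<Longrightarrow> m \<le> n \<Longrightarrow> pfx x n \<noteq> pfx y n"
  by (auto simp: list_eq_iff_nth_eq) (metis less_le_trans)

lemma ex_pfx_neq:
  assumes "x \<noteq> y" obtains n where "pfx x n \<noteq> pfx y n"
proof -
  obtain i where "x i \<noteq> y i" using assms by blast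
  then have "pfx x (Suc i) \<noteq> pfx y (Suc i)" by (auto simp: list_eq_iff_nth_eq)
  then show ?thesis by (rule that)
qed

lemma dyadic_pre [simp]: "pre u x \<in> dyadic \<longleftrightarrow> x \<in> dyadic"
proof
  assume "pre u x \<in> dyadic"
  then obtain N where N: "\<forall>n\<ge>N. \<not> pre u x n" by (auto simp: dyadic_def)
  have "\<forall>n\<ge>N. \<not> x n"
  proof (intro allI impI)
    fix n assume "N \<le> n"
    then have "\<not> pre u x (n + length u)" using N by auto
    then show "\<not> x n" by (simp add: pre_def)
  qed
  then show "x \<in> dyadic" by (auto simp: dyadic_def)
next
  assume "x \<in> dyadic"
  then obtain N where N: "\<forall>n\<ge>N. \<not> x n" by (auto simp: dyadic_def)
  have "\<forall>n\<ge>N + length u. \<not> pre u x n" using N by (auto simp: pre_def)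
  then show "pre u x \<in> dyadic" unfolding dyadic_def by blast
qed

lemma zeros_dyadic [simp]: "zeros \<in> dyadic"
  by (simp add: zeros_def dyadic_def)

lemma pre_False_zeros [simp]: "pre [False] zeros = zeros"
  by (auto simp: pre_def zeros_def)

lemma dyadic_pre_zeros:
  assumes "x \<in> dyadic" obtains N where "\<And>n. n \<ge> N \<Longrightarrow> pre (pfx x n) zeros = x"
proof -
  obtain N where N: "\<forall>n\<ge>N. \<not> x n" using assms by (auto simp: dyadic_def)
  have "pre (pfx x n) zeros = x" if "n \<ge> N" for n
    using N that by (auto simp: pre_def zeros_def fun_eq_iff)
  then show ?thesis by (rule that)
qed

text \<open>Evaluation at \<open>zeros\<close> alone cannot separate \<open>p\<close> from
  \<open>p @ [False]\<close>. It does show that the shorter word is a prefix of the longer; a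
  surplus \<open>r\<close> is then excluded by a dyadic point starting with the letter opposite to
  \<open>hd r\<close>.\<close>

lemma pre_eq_on_dyadic:
  assumes "\<And>y. y \<in> dyadic \<Longrightarrow> pre p y = pre q y" shows "p = q"
proof -
  have *: "r = []" if "\<And>y. y \<in> dyadic \<Longrightarrow> pre r y = y" for r
  proof (rule ccontr)
    assume "r \<noteq> []"
    then have "pre r (pre [\<not> hd r] zeros) 0 = hd r" by (simp add: pre_def hd_conv_nth)
    moreover have "pre [\<not> hd r] zeros 0 = (\<not> hd r)" by (simp add: pre_def)
    ultimately show False using that[of "pre [\<not> hd r] zeros"] by simp
  qed
  have **: "p = q" if le: "length p \<le> length q"
    and eq: "\<And>y. y \<in> dyadic \<Longrightarrow> pre p y = pre q y" for p q
  proof -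
    have "take (length p) q = p"
    proof (rule nth_equalityI)
      fix i assume "i < length (take (length p) q)"
      then have i: "i < length p" using le by simp
      have "pre p zeros i = pre q zeros i" using eq by simp
      then show "take (length p) q ! i = p ! i" using i le by (simp add: pre_def)
    qed (use le in simp)
    then obtain r where r: "q = p @ r" by (metis append_take_drop_id)
    have "r = []" using * eq r by (metis pre_append pre_inj)
    then show ?thesis using r by simp
  qed
  show ?thesis using **[of p q] **[of q p] assms by (metis nat_le_linear)
qed

section \<open>Thompson's group V\<close>

text \<open>Both words of a local rule are forced, being prefixes of \<open>x\<close> and
  \<open>f x\<close>. Recording only their lengths loses nothing and turns refinement of a rule into
  addition.\<close>

definition loc :: "(cantor \<Rightarrow> cantor) \<Rightarrow> cantor \<Rightarrow> nat \<Rightarrow> nat \<Rightarrow> bool" where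
  "loc f x m k \<longleftrightarrow> (\<forall>y. f (pre (pfx x m) y) = pre (pfx (f x) k) y)"

lemma locI:
  assumes "x \<in> cone u" and "\<And>y. f (pre u y) = pre w y"
  shows "loc f x (length u) (length w)"
proof -
  obtain y where "x = pre u y" using assms(1) by (rule in_coneE)
  then have "pfx x (length u) = u" "pfx (f x) (length w) = w" using assms(2) by simp_all
  then show ?thesis using assms(2) by (simp add: loc_def)
qed

lemma loc_add: "loc f x m k \<Longrightarrow> loc f x (m + j) (k + j)"
proof -
  assume l: "loc f x m k"
  have "f x = pre (pfx (f x) k) (tail m x)"
    using l[unfolded loc_def, rule_format, of "tail m x"] by simp
  then have "tail k (f x) = tail m x"
    by (metis pre_pfx_tail pre_inj)
  then show ?thesis using l unfolding loc_def by (simp add: pfx_add pre_append)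
qed

text \<open>Both rules are refined to depth \<open>m + m'\<close>. There they have the same source
  word, so the target words act alike, coincide, and have equal length.\<close>

lemma loc_unique:
  assumes "loc f x m k" and "loc f x m' k'"
  shows "int m - int k = int m' - int k'"
proof -
  have 1: "loc f x (m + m') (k + m')" and 2: "loc f x (m + m') (k' + m)"
    using loc_add[OF assms(1), of m'] loc_add[OF assms(2), of m] by (simp_all add: add.commute)
  have "pre (pfx (f x) (k + m')) y = pre (pfx (f x) (k' + m)) y" for y
    using 1 2 unfolding loc_def by metis
  then have "pfx (f x) (k + m') = pfx (f x) (k' + m)" by (rule pre_eq_on_dyadic)
  then have "k + m' = k' + m" by (metis length_pfx)
  then show ?thesis by linarith
qed

lemma log2_slope_loc:
  assumes "loc f x m k" shows "log2_slope f x = int m - int k"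
  unfolding log2_slope_def
proof (rule the_equality)
  show "\<exists>u w. x \<in> cone u \<and> (\<forall>y. f (pre u y) = pre w y) \<and> int m - int k = int (length u) - int (length w)"
    using assms unfolding loc_def by (intro exI[of _ "pfx x m"] exI[of _ "pfx (f x) k"]) simp
next
  fix j assume "\<exists>u w. x \<in> cone u \<and> (\<forall>y. f (pre u y) = pre w y) \<and> j = int (length u) - int (length w)"
  then show "j = int m - int k" using locI loc_unique[OF assms] by metis
qed

lemma loc_comp:
  assumes "loc g x m k" and "loc f (g x) m' k'"
  shows "loc (f \<circ> g) x (m + m') (k' + k)"
  using loc_add[OF assms(1), of m'] loc_add[OF assms(2), of k]
  unfolding loc_def by (simp add: add.commute)

lemma loc_inv:
  assumes "inj f" and "loc f x m k" shows "loc (hinv f) (f x) k m"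
  using assms unfolding loc_def by (metis inv_f_f)

lemma complete_prefix_code_pfx:
  assumes "distinct us" "set us = {u. length u = n}"
  shows "complete_prefix_code us"
  unfolding complete_prefix_code_def
proof
  fix x
  have "pfx x n \<in> set us" using assms(2) by simp
  then obtain i where i: "i < length us" "us ! i = pfx x n" by (auto simp: in_set_conv_nth)
  show "\<exists>!i. i < length us \<and> x \<in> cone (us ! i)"
  proof (rule ex1I[of _ i])
    show "i < length us \<and> x \<in> cone (us ! i)" using i by simp
    fix j assume j: "j < length us \<and> x \<in> cone (us ! j)"
    then have "length (us ! j) = n" using assms(2) nth_mem by blast
    then have "us ! j = us ! i" using j i by (simp add: cone_iff)
    then show "j = i" using j i assms(1) nth_eq_iff_index_eq by blast
  qed
qed

text \<open>Compactness of the Cantor space in the form of Koenig's lemma: if no depth works below a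
  word, none works below one of its two children, and following bad children yields a point without
  a local rule.\<close>

lemma uniform_local_depth:
  assumes "\<And>x. \<exists>m k. loc f x m k"
  shows "\<exists>n. \<forall>u. length u = n \<longrightarrow> (\<exists>w. \<forall>y. f (pre u y) = pre w y)"
proof (rule ccontr)
  define good where "good u \<longleftrightarrow> (\<exists>w. \<forall>y. f (pre u y) = pre w y)" for u
  define fin where "fin u \<longleftrightarrow> (\<exists>n. \<forall>s. length s = n \<longrightarrow> good (u @ s))" for u
  assume "\<not> ?thesis"
  then have nil: "\<not> fin []" by (simp add: good_def fin_def)
  have good_app: "good (u @ s)" if "good u" for u s
    using that unfolding good_def pre_append by (metis pre_append)
  have step: "fin u" if fin0: "fin (u @ [False])" and fin1: "fin (u @ [True])" for u
  proof -
    obtain n0 where n0: "\<And>s. length s = n0 \<Longrightarrow> good ((u @ [False]) @ s)" using fin0 fin_def by blast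
    obtain n1 where n1: "\<And>s. length s = n1 \<Longrightarrow> good ((u @ [True]) @ s)" using fin1 fin_def by blast
    have "good (u @ s)" if s: "length s = Suc (n0 + n1)" for s
    proof -
      obtain b t where bt: "s = b # t" "length t = n0 + n1" using s by (cases s) auto
      show ?thesis
      proof (cases b)
        case True
        have "good (((u @ [True]) @ take n1 t) @ drop n1 t)"
          by (rule good_app, rule n1) (use bt in simp)
        then show ?thesis using bt True by simp
      next
        case False
        have "good (((u @ [False]) @ take n0 t) @ drop n0 t)"
          by (rule good_app, rule n0) (use bt in simp)
        then show ?thesis using bt False by simp
      qed
    qed
    then show ?thesis unfolding fin_def by blast
  qed
  \<comment> \<open>The branch turns to the \<open>True\<close> child exactly when the
    \<open>False\<close> child is \<open>fin\<close>; by \<open>step\<close> the chosen child is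
    then never \<open>fin\<close>.\<close>
  define U where "U = rec_nat [] (\<lambda>_ u. u @ [fin (u @ [False])])"
  have U0: "U 0 = []" and US: "U (Suc n) = U n @ [fin (U n @ [False])]" for n
    by (simp_all add: U_def)
  have Ufin: "\<not> fin (U n)" for n
    by (induction n) (use nil step in \<open>auto simp: U0 US\<close>, metis)
  have Ulen: "length (U n) = n" for n by (induction n) (auto simp: U0 US)
  define x where "x n = U (Suc n) ! n" for n
  have Ux: "U n = pfx x n" for n
  proof (induction n)
    case (Suc n)
    have "x n = fin (U n @ [False])" by (simp add: x_def US nth_append Ulen)
    moreover have "pfx x (Suc n) = pfx x n @ [x n]" by (simp add: pfx_def)
    ultimately show ?case using Suc US by simp
  qed (simp add: U0 pfx_def)
  obtain m k where "loc f x m k" using assms by blast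
  then have "good (U m)" unfolding good_def Ux loc_def by blast
  then have "fin (U m)" unfolding fin_def using good_app by blast
  then show False using Ufin by blast
qed

text \<open>The pointwise form makes closure under composition and inverse immediate, with no common
  refinement of prefix codes. Conversely, all words of one uniform length form the source code, and
  their images form a complete code because \<open>f\<close> is bijective.\<close>

lemma V_iff: "f \<in> thompsonV_set \<longleftrightarrow> bij f \<and> (\<forall>x. \<exists>m k. loc f x m k)"
proof
  assume "f \<in> thompsonV_set"
  then obtain us ws where len: "length us = length ws" and us: "complete_prefix_code us"
    and ws: "complete_prefix_code ws" and f: "\<And>i y. i < length us \<Longrightarrow> f (pre (us ! i) y) = pre (ws ! i) y"
    unfolding thompsonV_set_def by blast
  have loc: "\<exists>i<length us. x \<in> cone (us ! i) \<and> (\<forall>y. f (pre (us ! i) y) = pre (ws ! i) y)" for x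
  proof -
    obtain i where "i < length us" "x \<in> cone (us ! i)"
      using us unfolding complete_prefix_code_def by meson
    then show ?thesis using f by metis
  qed
  have "inj f"
  proof (rule injI)
    fix x y assume eq: "f x = f y"
    obtain i where i: "i < length us" "x \<in> cone (us ! i)" using loc by blast
    obtain j where j: "j < length us" "y \<in> cone (us ! j)" using loc by blast
    obtain x' y' where xy: "x = pre (us ! i) x'" "y = pre (us ! j) y'" using i j in_coneE by metis
    then have eq': "pre (ws ! i) x' = pre (ws ! j) y'" using f i j eq by simp
    then have "i = j" using ws i j len unfolding complete_prefix_code_def by (metis pre_in_cone)
    then show "x = y" using xy eq' by simp
  qed
  moreover have "surj f"
  proof (rule surjI[of _ "hinv f"])
    fix x
    obtain i where i: "i < length ws" "x \<in> cone (ws ! i)"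
      using ws unfolding complete_prefix_code_def by blast
    then obtain y where "x = pre (ws ! i) y" using in_coneE by blast
    then have "x = f (pre (us ! i) y)" using f i len by simp
    then show "f (hinv f x) = x" by (simp add: \<open>inj f\<close>)
  qed
  ultimately show "bij f \<and> (\<forall>x. \<exists>m k. loc f x m k)"
    unfolding bij_def using loc locI by metis
next
  assume f: "bij f \<and> (\<forall>x. \<exists>m k. loc f x m k)"
  obtain n where n: "\<And>u. length u = n \<Longrightarrow> \<exists>w. \<forall>y. f (pre u y) = pre w y"
    using uniform_local_depth[of f] f by blast
  define W where "W u = (SOME w. \<forall>y. f (pre u y) = pre w y)" for u
  have W: "f (pre u y) = pre (W u) y" if "length u = n" for u y
    unfolding W_def using someI_ex[OF n[OF that]] by blast
  define us where "us = List.n_lists n [False, True]"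
  have dus: "distinct us" unfolding us_def by (rule distinct_n_lists) simp
  have sus: "set us = {u. length u = n}" unfolding us_def set_n_lists by auto
  have us: "complete_prefix_code us" by (rule complete_prefix_code_pfx[OF dus sus])
  have usl: "length (us ! i) = n" if "i < length us" for i using sus nth_mem that by blast
  have "complete_prefix_code (map W us)"
    unfolding complete_prefix_code_def
  proof
    fix x
    obtain x' where x': "x = f x'" using f by (metis bij_pointE)
    have iff: "i < length us \<and> x \<in> cone (W (us ! i)) \<longleftrightarrow> i < length us \<and> x' \<in> cone (us ! i)" for i
    proof -
      have "x \<in> cone (W (us ! i)) \<longleftrightarrow> x' \<in> cone (us ! i)" if i: "i < length us"
      proof
        assume "x \<in> cone (W (us ! i))"
        then obtain y where "x = pre (W (us ! i)) y" using in_coneE by blast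
        then have "f x' = f (pre (us ! i) y)" using W usl[OF i] x' by simp
        then have "x' = pre (us ! i) y" using f by (metis bij_pointE)
        then show "x' \<in> cone (us ! i)" by simp
      next
        assume "x' \<in> cone (us ! i)"
        then obtain y where "x' = pre (us ! i) y" using in_coneE by blast
        then show "x \<in> cone (W (us ! i))" using W usl[OF i] x' by simp
      qed
      then show ?thesis by blast
    qed
    show "\<exists>!i. i < length (map W us) \<and> x \<in> cone (map W us ! i)"
    proof -
      obtain i where i: "i < length us" "x' \<in> cone (us ! i)"
        and u: "\<And>j. j < length us \<Longrightarrow> x' \<in> cone (us ! j) \<Longrightarrow> j = i"
        using us unfolding complete_prefix_code_def by meson
      show ?thesis 
      proof (rule ex1I[of _ i])
        show "i < length (map W us) \<and> x \<in> cone (map W us ! i)" using i iff[of i] by simp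
        show "j = i" if "j < length (map W us) \<and> x \<in> cone (map W us ! j)" for j
          using that u[of j] iff[of j] by auto
      qed
    qed
  qed
  moreover have "\<forall>i < length us. \<forall>y. f (pre (us ! i) y) = pre (map W us ! i) y"
    using W usl by simp
  ultimately show "f \<in> thompsonV_set"
    unfolding thompsonV_set_def mem_Collect_eq using us
    by (intro exI[of _ us] exI[of _ "map W us"]) simp
qed

lemma V_bij: "f \<in> thompsonV_set \<Longrightarrow> bij f"
  by (simp add: V_iff)

lemma V_locE:
  assumes "f \<in> thompsonV_set" obtains m k where "loc f x m k"
  using assms V_iff by blast

lemma V_id [simp]: "id \<in> thompsonV_set"
proof -
  have "loc id x 0 0" for x by (simp add: loc_def pfx_def)
  then show ?thesis unfolding V_iff by blast
qed

lemma V_comp [simp]: "f \<in> thompsonV_set \<Longrightarrow> g \<in> thompsonV_set \<Longrightarrow> f \<circ> g \<in> thompsonV_set"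
  unfolding V_iff by (metis bij_comp loc_comp)

lemma V_inv [simp]: "f \<in> thompsonV_set \<Longrightarrow> hinv f \<in> thompsonV_set"
  unfolding V_iff by (metis bij_imp_bij_inv bij_inv_eq_iff bij_is_inj loc_inv)

lemma V_inv_f [simp]: "f \<in> thompsonV_set \<Longrightarrow> hinv f (f x) = x"
  by (simp add: V_bij bij_is_inj)

lemma V_f_inv [simp]: "f \<in> thompsonV_set \<Longrightarrow> f (hinv f x) = x"
  by (simp add: V_bij bij_is_surj surj_f_inv_f)

lemma V_eq_iff [simp]: "f \<in> thompsonV_set \<Longrightarrow> f x = f y \<longleftrightarrow> x = y"
  by (metis V_inv_f)

lemma V_inv_eq: "f \<in> thompsonV_set \<Longrightarrow> hinv f x = y \<longleftrightarrow> x = f y"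
  by (metis V_inv_f V_f_inv)

lemma V_inv_comp: "f \<in> thompsonV_set \<Longrightarrow> hinv f \<circ> f = id" "f \<in> thompsonV_set \<Longrightarrow> f \<circ> hinv f = id"
  by (auto simp: fun_eq_iff)

lemma V_dyadic [simp]:
  assumes "f \<in> thompsonV_set" shows "f x \<in> dyadic \<longleftrightarrow> x \<in> dyadic"
proof -
  obtain m k where "loc f x m k" using assms by (rule V_locE)
  then have "f (pre (pfx x m) (tail m x)) = pre (pfx (f x) k) (tail m x)"
    unfolding loc_def by blast
  then have "f x = pre (pfx (f x) k) (tail m x)" by simp
  then show ?thesis by (metis dyadic_pre pre_pfx_tail)
qed

lemma V_inv_dyadic [simp]: "f \<in> thompsonV_set \<Longrightarrow> hinv f x \<in> dyadic \<longleftrightarrow> x \<in> dyadic"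
  by (metis V_dyadic V_f_inv)

lemma log2_slope_id [simp]: "log2_slope id x = 0"
  using log2_slope_loc[of id x 0 0] by (simp add: loc_def pfx_def)

lemma log2_slope_comp:
  assumes "f \<in> thompsonV_set" "g \<in> thompsonV_set"
  shows "log2_slope (f \<circ> g) x = log2_slope f (g x) + log2_slope g x"
proof -
  obtain m k where 1: "loc g x m k" using assms(2) by (rule V_locE)
  obtain m' k' where 2: "loc f (g x) m' k'" using assms(1) by (rule V_locE)
  show ?thesis
    using log2_slope_loc[OF 1] log2_slope_loc[OF 2] log2_slope_loc[OF loc_comp[OF 1 2]] by simp
qed

lemma log2_slope_inv:
  assumes "f \<in> thompsonV_set"
  shows "log2_slope (hinv f) (f x) = - log2_slope f x"
  using log2_slope_comp[of "hinv f" f x] assms by (simp add: V_inv_comp)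

lemma V_slope0_local_id:
  assumes "f \<in> thompsonV_set" "f x = x" "log2_slope f x = 0"
  obtains m where "\<And>z. z \<in> cone (pfx x m) \<Longrightarrow> f z = z"
proof -
  obtain m k where l: "loc f x m k" using assms(1) by (rule V_locE)
  then have "m = k" using log2_slope_loc assms(3) by fastforce
  then have "f (pre (pfx x m) y) = pre (pfx x m) y" for y
    using l assms(2) by (simp add: loc_def)
  then show ?thesis using that by (metis in_coneE)
qed

lemma V_local_id_slope0:
  assumes "\<And>z. z \<in> cone u \<Longrightarrow> f z = z" "x \<in> cone u"
  shows "log2_slope f x = 0"
proof -
  have "loc f x (length u) (length u)" by (rule locI[of _ u]) (use assms in auto)
  then show ?thesis by (simp add: log2_slope_loc)
qed

text \<open>A local rule at \<open>x\<close> is refined until its source cone lies inside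
  \<open>cone u\<close>. Its two words then agree on all dyadic tails, hence are equal, which gives
  both the fixed point and the slope.\<close>

lemma V_dyadic_local_id:
  assumes "f \<in> thompsonV_set" "x \<in> cone u" "\<And>z. z \<in> cone u \<Longrightarrow> z \<in> dyadic \<Longrightarrow> f z = z"
  shows "f x = x \<and> log2_slope f x = 0"
proof -
  obtain m k where l: "loc f x m k" using assms(1) by (rule V_locE)
  define n where "n = m + length u"
  have l': "loc f x n (k + length u)" unfolding n_def by (rule loc_add[OF l])
  have "pre (pfx x n) y \<in> cone u" for y
  proof -
    have "pfx x n = u @ pfx (tail (length u) x) m"
      using pfx_add[of x "length u" m] assms(2) by (simp add: n_def cone_iff add.commute)
    then show ?thesis using cone_append_subset pre_in_cone by (metis subset_iff)
  qed
  then have "pre (pfx x n) y = pre (pfx (f x) (k + length u)) y" if "y \<in> dyadic" for y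
    using assms(3) l' that unfolding loc_def by (metis dyadic_pre)
  then have eq: "pfx x n = pfx (f x) (k + length u)" by (rule pre_eq_on_dyadic)
  then have "n = k + length u" by (metis length_pfx)
  moreover have "f x = x" using l' eq unfolding loc_def by (metis pre_pfx_tail)
  ultimately show ?thesis using log2_slope_loc[OF l'] by simp
qed

lemma V_eq_idI:
  assumes "f \<in> thompsonV_set" "\<And>z. z \<in> dyadic \<Longrightarrow> f z = z" shows "f = id"
  using V_dyadic_local_id[OF assms(1), of _ "[]"] assms(2) by (auto simp: fun_eq_iff)

text \<open>Once the source cone is deep enough, every image shares with \<open>f x\<close> a prefix
  that already differs from that of \<open>x\<close>. The bound holds for all larger depths, so that
  two elements can be handled on one common cone.\<close>

lemma V_move_cone:
  assumes "f \<in> thompsonV_set" "f x \<noteq> x"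
  obtains n where "\<And>m z. m \<ge> n \<Longrightarrow> z \<in> cone (pfx x m) \<Longrightarrow> f z \<notin> cone (pfx x m)"
proof -
  obtain m k where l: "loc f x m k" using assms(1) by (rule V_locE)
  obtain d where d: "pfx (f x) d \<noteq> pfx x d" using ex_pfx_neq[OF assms(2)] by blast
  have "f z \<notin> cone (pfx x j)" if j: "j \<ge> m + d" and z: "z \<in> cone (pfx x j)" for j z
  proof
    assume fz: "f z \<in> cone (pfx x j)"
    obtain y where "z = pre (pfx x j) y" using z in_coneE by blast
    moreover have "pfx x j = pfx x (m + d) @ pfx (tail (m + d) x) (j - (m + d))"
      using pfx_add[of x "m + d" "j - (m + d)"] j by simp
    ultimately obtain y' where "z = pre (pfx x (m + d)) y'" by (metis pre_append)
    then have "f z = pre (pfx (f x) (k + d)) y'" using loc_add[OF l, of d] unfolding loc_def by blast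
    then have "\<forall>i<d. f z i = f x i" by (simp add: pre_def)
    moreover have "\<forall>i<d. f z i = x i" using fz j by (auto simp: cone_def)
    ultimately show False using d by (auto simp: list_eq_iff_nth_eq)
  qed
  then show ?thesis by (rule that)
qed

section \<open>Swaps of cones\<close>

definition swp :: "bool list \<Rightarrow> bool list \<Rightarrow> cantor \<Rightarrow> cantor" where
  "swp u w x = (if x \<in> cone u then pre w (tail (length u) x)
     else if x \<in> cone w then pre u (tail (length w) x) else x)"

definition indep :: "bool list \<Rightarrow> bool list \<Rightarrow> bool" where
  "indep u w \<longleftrightarrow> cone u \<inter> cone w = {}"

lemma indep_sym: "indep u w \<Longrightarrow> indep w u"
  by (auto simp: indep_def)

lemma indep_append [simp]: "indep (u @ s) (u @ t) \<longleftrightarrow> indep s t"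
proof -
  have "(\<exists>x. x \<in> cone (u @ s) \<and> x \<in> cone (u @ t)) \<longleftrightarrow> (\<exists>x. x \<in> cone s \<and> x \<in> cone t)"
    by (metis cone_append_subset in_coneE pre_in_cone_append subsetD)
  then show ?thesis unfolding indep_def by blast
qed

lemma indep_Cons [simp]: "indep (a # s) (b # t) \<longleftrightarrow> a \<noteq> b \<or> indep s t"
proof (cases "a = b")
  case True
  then show ?thesis using indep_append[of "[a]" s t] by simp
next
  case False
  then have "indep (a # s) (b # t)"
    unfolding indep_def by (auto simp: cone_def)
  then show ?thesis using False by simp
qed

lemma indep_appendI: "indep u w \<Longrightarrow> indep (u @ s) (w @ t)"
  using cone_append_subset[of u s] cone_append_subset[of w t] by (auto simp: indep_def)

lemma swp_left [simp]: "swp u w (pre u y) = pre w y"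
  by (simp add: swp_def)

lemma swp_right [simp]: "indep u w \<Longrightarrow> swp u w (pre w y) = pre u y"
  by (auto simp: swp_def indep_def)

lemma swp_other: "x \<notin> cone u \<Longrightarrow> x \<notin> cone w \<Longrightarrow> swp u w x = x"
  by (simp add: swp_def)

lemma swp_cases:
  obtains y where "x = pre u y" | y where "x = pre w y" | "x \<notin> cone u" "x \<notin> cone w"
  using in_coneE by metis

lemma swp_swp [simp]: "indep u w \<Longrightarrow> swp u w (swp u w x) = x"
  by (cases rule: swp_cases[where x = x and u = u and w = w]) (auto simp: swp_other)

lemma swp_comp_swp: "indep u w \<Longrightarrow> swp u w \<circ> swp u w = id"
  by (auto simp: fun_eq_iff)

lemma swp_local_id:
  assumes "x \<notin> cone u" "x \<notin> cone w" "z \<in> cone (pfx x (max (length u) (length w)))"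
  shows "swp u w z = z"
proof -
  have "z i = x i" if "i < max (length u) (length w)" for i
    using assms(3) that by (simp add: cone_def)
  then have "z \<notin> cone u" "z \<notin> cone w" using assms(1,2) unfolding cone_def by fastforce+
  then show ?thesis by (rule swp_other)
qed

lemma swp_V [simp]:
  assumes "indep u w" shows "swp u w \<in> thompsonV_set"
proof -
  have "bij (swp u w)" by (rule involuntory_imp_bij) (simp add: assms)
  moreover have "\<exists>m k. loc (swp u w) x m k" for x
  proof (cases rule: swp_cases[where x = x and u = u and w = w])
    case (1 y)
    then show ?thesis by (metis locI pre_in_cone swp_left)
  next
    case (2 y)
    then show ?thesis by (metis locI pre_in_cone swp_right[OF assms])
  next
    case 3
    then have "loc (swp u w) x (length (pfx x (max (length u) (length w)))) (length (pfx x (max (length u) (length w))))"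
      by (intro locI) (simp_all add: swp_local_id)
    then show ?thesis by blast
  qed
  ultimately show ?thesis by (simp add: V_iff)
qed

lemma swp_moves:
  assumes "indep u w" "x \<in> cone u \<union> cone w" shows "swp u w x \<noteq> x"
proof (cases rule: swp_cases[where x = x and u = u and w = w])
  case (1 y)
  then have "swp u w x \<in> cone w" "x \<notin> cone w"
    using assms(1) pre_in_cone[of u y] by (simp_all add: indep_def disjoint_iff)
  then show ?thesis by metis
next
  case (2 y)
  then have "swp u w x \<in> cone u" "x \<notin> cone u"
    using assms(1) pre_in_cone[of w y] by (simp_all, auto simp: indep_def)
  then show ?thesis by metis
qed (use assms(2) in blast)

text \<open>Being the identity with slope one at a dyadic point amounts to being the identity near it, so
  this is the rigid stabilizer of a clopen set.\<close>
definition supported :: "(cantor \<Rightarrow> cantor) \<Rightarrow> cantor set \<Rightarrow> bool" where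
  "supported f I \<longleftrightarrow> f \<in> thompsonV_set \<and> (\<forall>x\<in>dyadic - I. f x = x \<and> log2_slope f x = 0)"

lemma supported_comp: "supported f I \<Longrightarrow> supported g I \<Longrightarrow> supported (f \<circ> g) I"
  by (auto simp: supported_def log2_slope_comp)

lemma supported_mono: "supported f I \<Longrightarrow> I \<subseteq> J \<Longrightarrow> supported f J"
  by (auto simp: supported_def)

lemma supported_swp: "indep u w \<Longrightarrow> supported (swp u w) (cone u \<union> cone w)"
  unfolding supported_def
proof (intro conjI ballI)
  fix x assume "x \<in> dyadic - (cone u \<union> cone w)"
  then have x: "x \<notin> cone u" "x \<notin> cone w" by auto
  show "swp u w x = x" by (rule swp_other[OF x])
  show "log2_slope (swp u w) x = 0"
    by (rule V_local_id_slope0[of "pfx x (max (length u) (length w))"]) (use swp_local_id[OF x] in auto)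
qed simp

lemma supported_swp_cone: "indep s t \<Longrightarrow> supported (swp (u @ s) (u @ t)) (cone u)"
  using supported_swp[of "u @ s" "u @ t"] supported_mono cone_append_subset[of u s]
    cone_append_subset[of u t] by (metis Un_least indep_append)

lemma supported_inv_mem:
  assumes "supported f I" "x \<in> dyadic" "x \<in> I" shows "hinv f x \<in> I"
proof (rule ccontr)
  assume n: "hinv f x \<notin> I"
  have f: "f \<in> thompsonV_set" using assms(1) by (simp add: supported_def)
  then have "hinv f x \<in> dyadic - I" using assms(2) n by simp
  then have "f (hinv f x) = hinv f x" using assms(1) unfolding supported_def by blast
  then show False using n assms(3) f V_f_inv by metis
qed

text \<open>At a depth beyond the last letter \<open>True\<close> of \<open>r\<close> and of
  \<open>q\<close> both continue with zeros only, so swapping their cones takes one exactly to the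
  other; the same depth is made large enough to separate the three points. Fixing \<open>p\<close>
  meanwhile is the double transitivity used later.\<close>

lemma swap_dyadic:
  assumes "r \<in> dyadic" "q \<in> dyadic" "r \<noteq> q" "p \<noteq> r" "p \<noteq> q"
  obtains u w where "indep u w" "p \<notin> cone u" "p \<notin> cone w" "swp u w r = q"
proof -
  obtain a where a: "\<And>n. n \<ge> a \<Longrightarrow> pre (pfx r n) zeros = r" using dyadic_pre_zeros[OF assms(1)] by meson
  obtain b where b: "\<And>n. n \<ge> b \<Longrightarrow> pre (pfx q n) zeros = q" using dyadic_pre_zeros[OF assms(2)] by meson
  obtain c where c: "pfx r c \<noteq> pfx q c" by (rule ex_pfx_neq[OF assms(3)])
  obtain d where d: "pfx p d \<noteq> pfx r d" by (rule ex_pfx_neq[OF assms(4)])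
  obtain e where e: "pfx p e \<noteq> pfx q e" by (rule ex_pfx_neq[OF assms(5)])
  define n where "n = a + b + c + d + e"
  have "pfx r n \<noteq> pfx q n" "pfx p n \<noteq> pfx r n" "pfx p n \<noteq> pfx q n"
    using pfx_neq_mono[OF c, of n] pfx_neq_mono[OF d, of n] pfx_neq_mono[OF e, of n]
    by (auto simp: n_def)
  moreover have "swp (pfx r n) (pfx q n) r = q"
    using swp_left[of "pfx r n" "pfx q n" zeros] a[of n] b[of n] by (metis n_def le_add1 le_add2 add.assoc le_trans)
  ultimately show ?thesis
    using that[of "pfx r n" "pfx q n"] pfx_eq_disjoint by (simp add: indep_def cone_iff)
qed

lemma V_transitive:
  assumes "r \<in> dyadic" "q \<in> dyadic" shows "\<exists>v\<in>thompsonV_set. v r = q"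
proof (cases "r = q")
  case False
  \<comment> \<open>A point that is not dyadic differs from both given points.\<close>
  define p :: cantor where "p = (\<lambda>_. True)"
  have "p \<notin> dyadic" by (auto simp: p_def dyadic_def)
  then have "p \<noteq> r" "p \<noteq> q" using assms by auto
  then show ?thesis using swap_dyadic[OF assms False] by (metis swp_V)
qed (use V_id id_apply in metis)

section \<open>The twisted wreath product\<close>

lemma aut_pow_0 [simp]: "aut_pow \<Gamma> \<alpha> 0 g = g"
  by (simp add: aut_pow_def)

lemma aut_pow_1 [simp]: "aut_pow \<Gamma> \<alpha> 1 g = \<alpha> g"
  by (simp add: aut_pow_def)

context
  fixes \<Gamma> :: "('g, 'm) monoid_scheme" and \<alpha> :: "'g \<Rightarrow> 'g"
  assumes bij: "bij_betw \<alpha> (carrier \<Gamma>) (carrier \<Gamma>)"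
begin

lemma aut_pow_closed:
  assumes "g \<in> carrier \<Gamma>" shows "aut_pow \<Gamma> \<alpha> n g \<in> carrier \<Gamma>"
proof -
  have "(f ^^ k) g \<in> carrier \<Gamma>" if "\<And>x. x \<in> carrier \<Gamma> \<Longrightarrow> f x \<in> carrier \<Gamma>" for f :: "'g \<Rightarrow> 'g" and k
    by (induction k) (use that assms in auto)
  note * = this
  show ?thesis
    unfolding aut_pow_def using *[of \<alpha>] *[of "inv_into (carrier \<Gamma>) \<alpha>"]
      bij_betwE[OF bij] bij_betwE[OF bij_betw_inv_into[OF bij]] by simp
qed

lemma aut_pow_Suc:
  assumes g: "g \<in> carrier \<Gamma>" shows "aut_pow \<Gamma> \<alpha> (n + 1) g = \<alpha> (aut_pow \<Gamma> \<alpha> n g)"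
proof (cases "0 \<le> n")
  case True
  then show ?thesis by (simp add: aut_pow_def nat_add_distrib)
next
  case False
  define k where "k = nat (- n - 1)"
  have n: "n = - int (Suc k)" using False by (simp add: k_def)
  have "aut_pow \<Gamma> \<alpha> (- int k) g = ((inv_into (carrier \<Gamma>) \<alpha>) ^^ k) g"
    by (cases k) (auto simp: aut_pow_def nat_add_distrib)
  moreover have "aut_pow \<Gamma> \<alpha> n g = inv_into (carrier \<Gamma>) \<alpha> (((inv_into (carrier \<Gamma>) \<alpha>) ^^ k) g)"
    unfolding n by (simp add: aut_pow_def nat_add_distrib)
  ultimately have "aut_pow \<Gamma> \<alpha> n g = inv_into (carrier \<Gamma>) \<alpha> (aut_pow \<Gamma> \<alpha> (n + 1) g)"
    by (simp add: n)
  then show ?thesis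
    using bij aut_pow_closed[OF g] by (simp add: bij_betw_inv_into_right)
qed

text \<open>A two-sided orbit is determined by one value, since a backward step is forced by
  injectivity. Identities between powers can thus be proved by checking a single forward step, with
  no separate treatment of negative exponents.\<close>

lemma aut_pow_unique:
  assumes closed: "\<And>n. F n \<in> carrier \<Gamma>" and step: "\<And>n. F (n + 1) = \<alpha> (F n)"
  shows "F n = aut_pow \<Gamma> \<alpha> n (F 0)"
proof (induction n rule: int_induct[where k = 0])
  case base
  show ?case by simp
next
  case (step1 i)
  then show ?case by (simp add: aut_pow_Suc closed step)
next
  case (step2 i)
  have "\<alpha> (F (i - 1)) = \<alpha> (aut_pow \<Gamma> \<alpha> (i - 1) (F 0))"
    using step2 step[of "i - 1"] aut_pow_Suc[OF closed, of "i - 1" 0] by simp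
  then show ?case
    using bij by (meson aut_pow_closed bij_betw_imp_inj_on closed inj_onD)
qed

lemma aut_pow_add:
  assumes g: "g \<in> carrier \<Gamma>"
  shows "aut_pow \<Gamma> \<alpha> (m + n) g = aut_pow \<Gamma> \<alpha> m (aut_pow \<Gamma> \<alpha> n g)"
  using aut_pow_unique[of "\<lambda>m. aut_pow \<Gamma> \<alpha> (m + n) g" m] aut_pow_closed[OF g]
    aut_pow_Suc[OF g, of "_ + n"] by (simp add: ac_simps)

lemma aut_pow_uminus:
  assumes "g \<in> carrier \<Gamma>" shows "aut_pow \<Gamma> \<alpha> n (aut_pow \<Gamma> \<alpha> (- n) g) = g"
  using aut_pow_add[OF assms, of n "- n"] by simp

lemma aut_pow_inj:
  assumes "g \<in> carrier \<Gamma>" "h \<in> carrier \<Gamma>"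
  shows "aut_pow \<Gamma> \<alpha> n g = aut_pow \<Gamma> \<alpha> n h \<longleftrightarrow> g = h"
  using aut_pow_uminus[of _ "- n"] assms by (metis minus_minus)

end

section \<open>The base group \<open>K\<close>, the group \<open>G\<close>, and conjugation on
  \<open>K\<close>\<close>

locale twisted = group \<Gamma> for \<Gamma> :: "('g, 'm) monoid_scheme" (structure) and \<alpha> :: "'g \<Rightarrow> 'g" +
  assumes aut: "\<alpha> \<in> iso \<Gamma> \<Gamma>"
begin

lemma aut_bij: "bij_betw \<alpha> (carrier \<Gamma>) (carrier \<Gamma>)"
  using aut by (simp add: iso_def)

lemma aut_mult: "g \<in> carrier \<Gamma> \<Longrightarrow> h \<in> carrier \<Gamma> \<Longrightarrow> \<alpha> (g \<otimes> h) = \<alpha> g \<otimes> \<alpha> h"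
  using aut by (simp add: iso_def hom_mult)

abbreviation pw where "pw \<equiv> aut_pow \<Gamma> \<alpha>"

lemmas pw_closed [simp, intro] = aut_pow_closed[OF aut_bij]
lemmas pw_add = aut_pow_add[OF aut_bij]
lemmas pw_inj = aut_pow_inj[OF aut_bij]

lemma pw_mult:
  assumes "g \<in> carrier \<Gamma>" "h \<in> carrier \<Gamma>" shows "pw n (g \<otimes> h) = pw n g \<otimes> pw n h"
  using aut_pow_unique[OF aut_bij, of "\<lambda>n. pw n g \<otimes> pw n h" n] assms
  by (simp add: aut_pow_Suc[OF aut_bij] aut_mult)

lemma pw_hom: "pw n \<in> hom \<Gamma> \<Gamma>"
  by (rule homI) (auto simp: pw_mult)

lemma pw_one [simp]: "pw n \<one> = \<one>"
  using hom_one[OF pw_hom] group_axioms by blast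

lemma pw_eq_one [simp]: "g \<in> carrier \<Gamma> \<Longrightarrow> pw n g = \<one> \<longleftrightarrow> g = \<one>"
  using pw_inj[of g \<one> n] by simp

definition K where "K = product_group dyadic (\<lambda>_. \<Gamma>)"

abbreviation G where "G \<equiv> G_alpha \<Gamma> \<alpha>"

lemma carrier_K: "carrier K = (dyadic \<rightarrow>\<^sub>E carrier \<Gamma>)"
  by (simp add: K_def)

lemma K_value [simp, intro]: "a \<in> carrier K \<Longrightarrow> x \<in> dyadic \<Longrightarrow> a x \<in> carrier \<Gamma>"
  by (auto simp: carrier_K)

lemma K_group: "group K"
  unfolding K_def by (simp add: group_axioms)

lemma K_mult [simp]: "x \<in> dyadic \<Longrightarrow> (a \<otimes>\<^bsub>K\<^esub> b) x = a x \<otimes> b x"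
  by (simp add: K_def)

lemma K_one [simp]: "x \<in> dyadic \<Longrightarrow> \<one>\<^bsub>K\<^esub> x = \<one>"
  by (simp add: K_def)

lemma K_inv [simp]: "a \<in> carrier K \<Longrightarrow> x \<in> dyadic \<Longrightarrow> (inv\<^bsub>K\<^esub> a) x = inv (a x)"
  using inv_product_group[of a dyadic "\<lambda>_. \<Gamma>"] group_axioms by (simp add: K_def)

lemma K_eqI:
  assumes "a \<in> carrier K" "b \<in> carrier K" "\<And>x. x \<in> dyadic \<Longrightarrow> a x = b x" shows "a = b"
  using assms unfolding carrier_K by (rule PiE_ext)

lemma K_memI: "(\<And>x. x \<in> dyadic \<Longrightarrow> f x \<in> carrier \<Gamma>) \<Longrightarrow> (\<lambda>x\<in>dyadic. f x) \<in> carrier K"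
  by (simp add: carrier_K)

lemma twist_apply:
  "x \<in> dyadic \<Longrightarrow> twist_action \<Gamma> \<alpha> v a x = pw (- log2_slope v (hinv v x)) (a (hinv v x))"
  by (simp add: twist_action_def)

lemma twist_apply_image:
  "v \<in> thompsonV_set \<Longrightarrow> x \<in> dyadic \<Longrightarrow> twist_action \<Gamma> \<alpha> v a (v x) = pw (- log2_slope v x) (a x)"
  by (simp add: twist_apply)

lemma twist_closed [simp, intro]:
  "v \<in> thompsonV_set \<Longrightarrow> a \<in> carrier K \<Longrightarrow> twist_action \<Gamma> \<alpha> v a \<in> carrier K"
  unfolding twist_action_def by (rule K_memI) auto

lemma twist_mult:
  assumes "v \<in> thompsonV_set" "a \<in> carrier K" "b \<in> carrier K"
  shows "twist_action \<Gamma> \<alpha> v (a \<otimes>\<^bsub>K\<^esub> b) = twist_action \<Gamma> \<alpha> v a \<otimes>\<^bsub>K\<^esub> twist_action \<Gamma> \<alpha> v b"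
proof -
  interpret Kg: group K by (rule K_group)
  show ?thesis
    by (rule K_eqI) (use assms in \<open>auto simp: twist_apply pw_mult\<close>)
qed

text \<open>The chain rule for slopes turns composition into addition of exponents; writing
  \<open>x\<close> as \<open>v (w y)\<close> keeps inverses out of the computation.\<close>

lemma twist_comp:
  assumes "v \<in> thompsonV_set" "w \<in> thompsonV_set" "a \<in> carrier K"
  shows "twist_action \<Gamma> \<alpha> (v \<circ> w) a = twist_action \<Gamma> \<alpha> v (twist_action \<Gamma> \<alpha> w a)"
proof (rule K_eqI)
  fix x assume "x \<in> dyadic"
  define y where "y = hinv w (hinv v x)"
  have y: "y \<in> dyadic" and x: "x = v (w y)" using assms \<open>x \<in> dyadic\<close> by (simp_all add: y_def)
  have "twist_action \<Gamma> \<alpha> (v \<circ> w) a x = pw (- log2_slope (v \<circ> w) y) (a y)"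
    using twist_apply_image[of "v \<circ> w" y a] assms y x by simp
  also have "\<dots> = pw (- log2_slope v (w y)) (pw (- log2_slope w y) (a y))"
    using assms y by (simp add: log2_slope_comp pw_add[symmetric])
  also have "\<dots> = twist_action \<Gamma> \<alpha> v (twist_action \<Gamma> \<alpha> w a) x"
    using assms y x by (simp add: twist_apply_image)
  finally show "twist_action \<Gamma> \<alpha> (v \<circ> w) a x = twist_action \<Gamma> \<alpha> v (twist_action \<Gamma> \<alpha> w a) x" .
qed (use assms in auto)

lemma twist_id: "a \<in> carrier K \<Longrightarrow> twist_action \<Gamma> \<alpha> id a = a"
  by (rule K_eqI) (auto simp: twist_apply inv_id)

lemma twist_one: "v \<in> thompsonV_set \<Longrightarrow> twist_action \<Gamma> \<alpha> v \<one>\<^bsub>K\<^esub> = \<one>\<^bsub>K\<^esub>"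
proof -
  assume v: "v \<in> thompsonV_set"
  interpret Kg: group K by (rule K_group)
  show ?thesis by (rule K_eqI) (use v in \<open>auto simp: twist_apply\<close>)
qed

lemma carrier_G: "carrier G = carrier K \<times> thompsonV_set"
  by (simp add: G_alpha_def carrier_K thompsonV_def)

lemma G_one: "\<one>\<^bsub>G\<^esub> = (\<one>\<^bsub>K\<^esub>, id)"
  by (simp add: G_alpha_def K_def)

lemma G_mult: "(a, v) \<otimes>\<^bsub>G\<^esub> (b, w) = (a \<otimes>\<^bsub>K\<^esub> twist_action \<Gamma> \<alpha> v b, v \<circ> w)"
  by (simp add: G_alpha_def K_def)

lemma snd_mult: "snd (X \<otimes>\<^bsub>G\<^esub> Y) = snd X \<circ> snd Y"
  by (cases X, cases Y) (simp add: G_mult)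

lemma G_group: "group G"
proof -
  interpret Kg: group K by (rule K_group)
  show ?thesis
  proof (rule groupI)
    fix X Y assume "X \<in> carrier G" "Y \<in> carrier G"
    then show "X \<otimes>\<^bsub>G\<^esub> Y \<in> carrier G"
      by (auto simp: carrier_G G_mult)
  next
    fix X Y Z assume "X \<in> carrier G" "Y \<in> carrier G" "Z \<in> carrier G"
    then show "X \<otimes>\<^bsub>G\<^esub> Y \<otimes>\<^bsub>G\<^esub> Z = X \<otimes>\<^bsub>G\<^esub> (Y \<otimes>\<^bsub>G\<^esub> Z)"
      by (auto simp: carrier_G G_mult twist_mult twist_comp Kg.m_assoc o_assoc)
  next
    show "\<one>\<^bsub>G\<^esub> \<in> carrier G" by (simp add: carrier_G G_one)
  next
    fix X assume "X \<in> carrier G"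
    then show "\<one>\<^bsub>G\<^esub> \<otimes>\<^bsub>G\<^esub> X = X"
      by (auto simp: carrier_G G_one G_mult twist_id)
  next
    fix X assume X: "X \<in> carrier G"
    obtain a v where av: "X = (a, v)" "a \<in> carrier K" "v \<in> thompsonV_set"
      using X by (auto simp: carrier_G)
    have "(inv\<^bsub>K\<^esub> (twist_action \<Gamma> \<alpha> (hinv v) a), hinv v) \<otimes>\<^bsub>G\<^esub> X = \<one>\<^bsub>G\<^esub>"
      using av by (simp add: G_mult G_one V_inv_comp)
    then show "\<exists>Y\<in>carrier G. Y \<otimes>\<^bsub>G\<^esub> X = \<one>\<^bsub>G\<^esub>"
      using av by (intro bexI) (auto simp: carrier_G)
  qed
qed

text \<open>Conjugation by \<open>X\<close> on the normal subgroup \<open>K\<close>, with values in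
  \<open>K\<close> instead of pairs; \<open>act_conj\<close> and \<open>act_unique\<close>
  characterize it.\<close>

definition act :: "(cantor \<Rightarrow> 'g) \<times> (cantor \<Rightarrow> cantor) \<Rightarrow> (cantor \<Rightarrow> 'g) \<Rightarrow> cantor \<Rightarrow> 'g" where
  "act X a = fst X \<otimes>\<^bsub>K\<^esub> twist_action \<Gamma> \<alpha> (snd X) a \<otimes>\<^bsub>K\<^esub> inv\<^bsub>K\<^esub> (fst X)"

lemma act_closed [simp, intro]: "X \<in> carrier G \<Longrightarrow> a \<in> carrier K \<Longrightarrow> act X a \<in> carrier K"
proof -
  interpret Kg: group K by (rule K_group)
  show "X \<in> carrier G \<Longrightarrow> a \<in> carrier K \<Longrightarrow> act X a \<in> carrier K"
    by (auto simp: act_def carrier_G)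
qed

lemma act_conj:
  assumes "X \<in> carrier G" "a \<in> carrier K"
  shows "X \<otimes>\<^bsub>G\<^esub> (a, id) = (act X a, id) \<otimes>\<^bsub>G\<^esub> X"
proof -
  interpret Kg: group K by (rule K_group)
  show ?thesis
    using assms by (auto simp: act_def carrier_G G_mult twist_id Kg.m_assoc)
qed

lemma act_unique:
  assumes "X \<in> carrier G" "a \<in> carrier K" "b \<in> carrier K" "X \<otimes>\<^bsub>G\<^esub> (a, id) = (b, id) \<otimes>\<^bsub>G\<^esub> X"
  shows "act X a = b"
proof -
  interpret Gg: group G by (rule G_group)
  have "(act X a, id) \<in> carrier G" "(b, id) \<in> carrier G" using assms by (auto simp: carrier_G)
  moreover have "(act X a, id) \<otimes>\<^bsub>G\<^esub> X = (b, id) \<otimes>\<^bsub>G\<^esub> X" using act_conj assms by simp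
  ultimately have "(act X a, id) = (b, id)" using assms(1) Gg.right_cancel by blast
  then show ?thesis by simp
qed

lemma act_image:
  assumes "X \<in> carrier G" "a \<in> carrier K" "x \<in> dyadic"
  shows "act X a (snd X x) = fst X (snd X x) \<otimes> pw (- log2_slope (snd X) x) (a x) \<otimes> inv (fst X (snd X x))"
  using assms by (auto simp: act_def carrier_G twist_apply_image)

lemma act_V:
  assumes "v \<in> thompsonV_set" "a \<in> carrier K" shows "act (\<one>\<^bsub>K\<^esub>, v) a = twist_action \<Gamma> \<alpha> v a"
proof -
  interpret Kg: group K by (rule K_group)
  show ?thesis using assms by (simp add: act_def)
qed

text \<open>The twist and the \<open>K\<close>-part of \<open>X\<close> act on each value by
  bijections that fix the identity, so only \<open>snd X\<close> affects where a function is
  nontrivial. This allows supports to be tracked even under elements with an unknown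
  \<open>K\<close>-part.\<close>

lemma act_one_iff:
  assumes "X \<in> carrier G" "a \<in> carrier K" "x \<in> dyadic"
  shows "act X a (snd X x) = \<one> \<longleftrightarrow> a x = \<one>"
proof -
  define c where "c = fst X (snd X x)"
  have c: "c \<in> carrier \<Gamma>" using assms by (auto simp: c_def carrier_G)
  have g: "a x \<in> carrier \<Gamma>" using assms by auto
  have "c \<otimes> pw (- log2_slope (snd X) x) (a x) \<otimes> inv c = \<one> \<longleftrightarrow> a x = \<one>"
  proof
    assume "c \<otimes> pw (- log2_slope (snd X) x) (a x) \<otimes> inv c = \<one>"
    then have "c \<otimes> pw (- log2_slope (snd X) x) (a x) = c"
      using c g inv_solve_right'[of "\<one>" "c \<otimes> pw (- log2_slope (snd X) x) (a x)" c]
      by simp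
    then show "a x = \<one>" using c g by simp
  qed (use c in simp)
  then show ?thesis using act_image[OF assms] by (simp add: c_def)
qed

lemma act_fixed_moves:
  assumes "X \<in> carrier G" "a \<in> carrier K" "act X a = a" "x \<in> dyadic"
  shows "a (snd X x) = \<one> \<longleftrightarrow> a x = \<one>"
  using act_one_iff[OF assms(1,2,4)] assms(3) by simp

definition delta :: "cantor \<Rightarrow> 'g \<Rightarrow> cantor \<Rightarrow> 'g" where
  "delta x g = (\<lambda>y\<in>dyadic. if y = x then g else \<one>)"

lemma delta_closed [simp, intro]: "g \<in> carrier \<Gamma> \<Longrightarrow> delta x g \<in> carrier K"
  unfolding delta_def by (rule K_memI) auto

lemma delta_apply [simp]: "y \<in> dyadic \<Longrightarrow> delta x g y = (if y = x then g else \<one>)"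
  by (simp add: delta_def)

definition trivial_off :: "(cantor \<Rightarrow> 'g) \<Rightarrow> cantor set \<Rightarrow> bool" where
  "trivial_off a I \<longleftrightarrow> a \<in> carrier K \<and> (\<forall>x\<in>dyadic - I. a x = \<one>)"

lemma trivial_off_delta: "g \<in> carrier \<Gamma> \<Longrightarrow> trivial_off (delta x g) {x}"
  by (simp add: trivial_off_def delta_closed)

lemma twist_disjoint:
  assumes "supported v I" "trivial_off a J" "I \<inter> J = {}"
  shows "twist_action \<Gamma> \<alpha> v a = a"
proof (rule K_eqI)
  have v: "v \<in> thompsonV_set" and a: "a \<in> carrier K"
    using assms by (auto simp: supported_def trivial_off_def)
  show "twist_action \<Gamma> \<alpha> v a \<in> carrier K" "a \<in> carrier K" using v a by auto
  fix x assume x: "x \<in> dyadic"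
  show "twist_action \<Gamma> \<alpha> v a x = a x"
  proof (cases "x \<in> I")
    case True
    then have "hinv v x \<in> I" using supported_inv_mem assms(1) x by blast
    then have "a (hinv v x) = \<one>" "a x = \<one>"
      using assms x True v unfolding trivial_off_def by (auto simp: disjoint_iff)
    then show ?thesis using x by (simp add: twist_apply)
  next
    case False
    then have "v x = x" "log2_slope v x = 0" using assms(1) x by (auto simp: supported_def)
    then show ?thesis using twist_apply_image[OF v x, of a] by simp
  qed
qed

lemma trivial_off_commutator:
  assumes "supported v I" "a \<in> carrier K"
  shows "trivial_off (twist_action \<Gamma> \<alpha> v a \<otimes>\<^bsub>K\<^esub> inv\<^bsub>K\<^esub> a) I"
proof -
  interpret Kg: group K by (rule K_group)
  have v: "v \<in> thompsonV_set" using assms by (simp add: supported_def)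
  have "(twist_action \<Gamma> \<alpha> v a \<otimes>\<^bsub>K\<^esub> inv\<^bsub>K\<^esub> a) x = \<one>" if "x \<in> dyadic - I" for x
  proof -
    have "v x = x" "log2_slope v x = 0" using assms(1) that by (auto simp: supported_def)
    then show ?thesis using twist_apply_image[OF v, of x a] that assms(2) by simp
  qed
  then show ?thesis using v assms(2) by (auto simp: trivial_off_def)
qed

end

section \<open>From a conjugacy of the automorphisms to an isomorphism of the groups\<close>

text \<open>Applying \<open>\<beta>\<close> pointwise commutes with the \<open>V\<close>-actions
  only up to conjugation. The defect is corrected by multiplying with a cocycle \<open>c\<close> in
  the exponent: \<open>c 1 = k\<close>, and \<open>c (m + n)\<close> is \<open>c m\<close> times the
  \<open>m\<close>-th power of \<open>\<alpha>'\<close> applied to \<open>c n\<close>.\<close>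

lemma G_alpha_iso_of_conjugate:
  fixes \<Gamma> :: "('g, 'm) monoid_scheme" and \<Gamma>' :: "('h, 'n) monoid_scheme"
  assumes "twisted \<Gamma> \<alpha>" and "twisted \<Gamma>' \<alpha>'"
    and \<beta>: "\<beta> \<in> iso \<Gamma> \<Gamma>'" and k: "k \<in> carrier \<Gamma>'"
    and conj: "\<And>g. g \<in> carrier \<Gamma> \<Longrightarrow> \<beta> (\<alpha> g) \<otimes>\<^bsub>\<Gamma>'\<^esub> k = k \<otimes>\<^bsub>\<Gamma>'\<^esub> \<alpha>' (\<beta> g)"
  shows "G_alpha \<Gamma> \<alpha> \<cong> G_alpha \<Gamma>' \<alpha>'"
proof -
  interpret A: twisted \<Gamma> \<alpha> by fact
  interpret B: twisted \<Gamma>' \<alpha>' by fact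
  interpret KA: group A.K by (rule A.K_group)
  interpret KB: group B.K by (rule B.K_group)
  have \<beta>c [simp]: "\<beta> g \<in> carrier \<Gamma>'" if "g \<in> carrier \<Gamma>" for g
    using \<beta> that by (auto simp: iso_def hom_def)
  have \<beta>m: "\<beta> (g \<otimes>\<^bsub>\<Gamma>\<^esub> h) = \<beta> g \<otimes>\<^bsub>\<Gamma>'\<^esub> \<beta> h" if "g \<in> carrier \<Gamma>" "h \<in> carrier \<Gamma>" for g h
    using \<beta> that by (simp add: iso_def hom_mult)
  have \<beta>b: "bij_betw \<beta> (carrier \<Gamma>) (carrier \<Gamma>')" using \<beta> by (simp add: iso_def)
  have \<alpha>c [simp]: "\<alpha>' g \<in> carrier \<Gamma>'" if "g \<in> carrier \<Gamma>'" for g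
    using B.aut_bij that bij_betwE by blast
  have \<alpha>c' [simp]: "\<alpha> g \<in> carrier \<Gamma>" if "g \<in> carrier \<Gamma>" for g
    using A.aut_bij that bij_betwE by blast
  \<comment> \<open>\<open>T\<close> is not a homomorphism, but it is a bijection of the carrier, so
    it has integer powers. Its orbit of the identity is the wanted cocycle, for negative exponents
    too.\<close>
  define T where "T g = k \<otimes>\<^bsub>\<Gamma>'\<^esub> \<alpha>' g" for g
  have "bij_betw (\<lambda>g. k \<otimes>\<^bsub>\<Gamma>'\<^esub> g) (carrier \<Gamma>') (carrier \<Gamma>')"
    by (rule bij_betw_byWitness[where f' = "\<lambda>g. inv\<^bsub>\<Gamma>'\<^esub> k \<otimes>\<^bsub>\<Gamma>'\<^esub> g"])
      (use k in \<open>auto simp: B.m_assoc[symmetric]\<close>)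
  then have T: "bij_betw T (carrier \<Gamma>') (carrier \<Gamma>')"
    using bij_betw_trans[OF B.aut_bij] by (simp add: T_def[abs_def] comp_def)
  define t where "t = aut_pow \<Gamma>' T"
  define c where "c n = t n \<one>\<^bsub>\<Gamma>'\<^esub>" for n
  have tc [simp]: "t n g \<in> carrier \<Gamma>'" if "g \<in> carrier \<Gamma>'" for n g
    unfolding t_def by (rule aut_pow_closed[OF T that])
  have cc [simp]: "c n \<in> carrier \<Gamma>'" for n by (simp add: c_def)
  have c_Suc: "c (n + 1) = T (c n)" for n
    unfolding c_def t_def by (rule aut_pow_Suc[OF T]) simp
  have c0: "c 0 = \<one>\<^bsub>\<Gamma>'\<^esub>" by (simp add: c_def t_def)
  have t_eq: "t n g = c n \<otimes>\<^bsub>\<Gamma>'\<^esub> B.pw n g" if g: "g \<in> carrier \<Gamma>'" for n g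
    using aut_pow_unique[OF T, of "\<lambda>n. c n \<otimes>\<^bsub>\<Gamma>'\<^esub> B.pw n g" n] g k
    by (simp add: t_def[symmetric] c0 c_Suc T_def B.aut_mult aut_pow_Suc[OF B.aut_bij] B.m_assoc)
  \<comment> \<open>Comparing this with \<open>t_eq\<close> at \<open>\<beta> g\<close> gives the
    intertwining relation between \<open>\<beta>\<close>, \<open>c n\<close> and the
    \<open>n\<close>-th powers of both automorphisms.\<close>
  have t_\<beta>: "t n (\<beta> g) = \<beta> (A.pw n g) \<otimes>\<^bsub>\<Gamma>'\<^esub> c n" if g: "g \<in> carrier \<Gamma>" for n g
  proof -
    have "\<beta> (A.pw (n + 1) g) \<otimes>\<^bsub>\<Gamma>'\<^esub> c (n + 1) = T (\<beta> (A.pw n g) \<otimes>\<^bsub>\<Gamma>'\<^esub> c n)" for n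
      using g k conj[of "A.pw n g"]
      by (simp add: c_Suc T_def B.aut_mult aut_pow_Suc[OF A.aut_bij] B.m_assoc[symmetric])
    then show ?thesis
      using aut_pow_unique[OF T, of "\<lambda>n. \<beta> (A.pw n g) \<otimes>\<^bsub>\<Gamma>'\<^esub> c n" n] g
      by (simp add: t_def[symmetric] c0)
  qed
  have c_add: "c (m + n) = c m \<otimes>\<^bsub>\<Gamma>'\<^esub> B.pw m (c n)" for m n
    using aut_pow_add[OF T, of "\<one>\<^bsub>\<Gamma>'\<^esub>" m n] t_eq[OF cc, of m n]
    by (simp add: c_def t_def)
  \<comment> \<open>The exponent with which \<open>v\<close> acts on the value arriving at
    \<open>x\<close>; the chain rule makes it additive along compositions.\<close>
  define e where "e v x = - log2_slope v (hinv v x)" for v x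
  define \<Phi> where "\<Phi> = (\<lambda>(a, v). (\<lambda>x\<in>dyadic. \<beta> (a x) \<otimes>\<^bsub>\<Gamma>'\<^esub> c (e v x), v))"
  have "\<Phi> \<in> hom A.G B.G"
  proof (rule homI)
    fix X assume "X \<in> carrier A.G"
    then show "\<Phi> X \<in> carrier B.G"
      by (auto simp: A.carrier_G B.carrier_G \<Phi>_def intro!: B.K_memI)
  next
    fix X Y assume "X \<in> carrier A.G" "Y \<in> carrier A.G"
    then obtain a v b w where X: "X = (a, v)" "a \<in> carrier A.K" "v \<in> thompsonV_set"
      and Y: "Y = (b, w)" "b \<in> carrier A.K" "w \<in> thompsonV_set"
      by (auto simp: A.carrier_G)
    define a' where "a' = (\<lambda>x\<in>dyadic. \<beta> (a x) \<otimes>\<^bsub>\<Gamma>'\<^esub> c (e v x))"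
    define b' where "b' = (\<lambda>x\<in>dyadic. \<beta> (b x) \<otimes>\<^bsub>\<Gamma>'\<^esub> c (e w x))"
    have ab: "a' \<in> carrier B.K" "b' \<in> carrier B.K"
      unfolding a'_def b'_def using X Y by (auto intro!: B.K_memI)
    have "(\<lambda>x\<in>dyadic. \<beta> ((a \<otimes>\<^bsub>A.K\<^esub> twist_action \<Gamma> \<alpha> v b) x) \<otimes>\<^bsub>\<Gamma>'\<^esub> c (e (v \<circ> w) x)) =
      a' \<otimes>\<^bsub>B.K\<^esub> twist_action \<Gamma>' \<alpha>' v b'" (is "?l = ?r")
    proof (rule B.K_eqI)
      show "?l \<in> carrier B.K" using X Y by (auto intro!: B.K_memI)
      show "?r \<in> carrier B.K" using ab X by auto
      fix x assume x: "x \<in> dyadic"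
      define z where "z = hinv v x"
      have z: "z \<in> dyadic" using x X by (simp add: z_def)
      have "hinv (v \<circ> w) x = hinv w z"
        using X Y by (simp add: z_def V_inv_eq)
      then have e: "e (v \<circ> w) x = e v x + e w z"
        using X Y by (simp add: e_def log2_slope_comp z_def)
      have [simp]: "a x \<in> carrier \<Gamma>" "b z \<in> carrier \<Gamma>" using X Y x z by auto
      have tA: "twist_action \<Gamma> \<alpha> v b x = A.pw (e v x) (b z)"
        and tB: "twist_action \<Gamma>' \<alpha>' v b' x = B.pw (e v x) (b' z)"
        using x by (simp_all add: A.twist_apply B.twist_apply e_def z_def)
      have "?l x = \<beta> (a x) \<otimes>\<^bsub>\<Gamma>'\<^esub> (\<beta> (A.pw (e v x) (b z)) \<otimes>\<^bsub>\<Gamma>'\<^esub> c (e v x)) \<otimes>\<^bsub>\<Gamma>'\<^esub> B.pw (e v x) (c (e w z))"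
        using x by (simp add: tA e c_add \<beta>m B.m_assoc)
      also have "\<dots> = \<beta> (a x) \<otimes>\<^bsub>\<Gamma>'\<^esub> (c (e v x) \<otimes>\<^bsub>\<Gamma>'\<^esub> B.pw (e v x) (\<beta> (b z))) \<otimes>\<^bsub>\<Gamma>'\<^esub> B.pw (e v x) (c (e w z))"
        using t_\<beta>[of "b z" "e v x"] t_eq[of "\<beta> (b z)" "e v x"] by simp
      also have "\<dots> = ?r x"
      proof -
        have "b' z = \<beta> (b z) \<otimes>\<^bsub>\<Gamma>'\<^esub> c (e w z)" using z by (simp add: b'_def)
        then show ?thesis using x by (simp add: tB B.pw_mult B.m_assoc) (simp add: a'_def B.m_assoc)
      qed
      finally show "?l x = ?r x" .
    qed
    then show "\<Phi> (X \<otimes>\<^bsub>A.G\<^esub> Y) = \<Phi> X \<otimes>\<^bsub>B.G\<^esub> \<Phi> Y"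
      by (simp add: X(1) Y(1) \<Phi>_def A.G_mult B.G_mult a'_def b'_def)
  qed
  moreover have "bij_betw \<Phi> (carrier A.G) (carrier B.G)"
  proof (rule bij_betw_byWitness[where f' = "\<lambda>(b, v). (\<lambda>x\<in>dyadic. inv_into (carrier \<Gamma>) \<beta> (b x \<otimes>\<^bsub>\<Gamma>'\<^esub> inv\<^bsub>\<Gamma>'\<^esub> c (e v x)), v)"])
    have 1: "inv_into (carrier \<Gamma>) \<beta> g \<in> carrier \<Gamma>" "\<beta> (inv_into (carrier \<Gamma>) \<beta> g) = g" if "g \<in> carrier \<Gamma>'" for g
      using \<beta>b that by (auto simp: bij_betw_inv_into_right bij_betw_def inv_into_into)
    have 2: "inv_into (carrier \<Gamma>) \<beta> (\<beta> g) = g" if "g \<in> carrier \<Gamma>" for g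
      using \<beta>b that by (simp add: bij_betw_inv_into_left)
    show "\<Phi> ` carrier A.G \<subseteq> carrier B.G"
      using \<open>\<Phi> \<in> hom A.G B.G\<close> by (auto simp: hom_def)
    show "(\<lambda>(b, v). (\<lambda>x\<in>dyadic. inv_into (carrier \<Gamma>) \<beta> (b x \<otimes>\<^bsub>\<Gamma>'\<^esub> inv\<^bsub>\<Gamma>'\<^esub> c (e v x)), v)) ` carrier B.G \<subseteq> carrier A.G"
      by (auto simp: A.carrier_G B.carrier_G 1 intro!: A.K_memI)
    show "\<forall>X\<in>carrier A.G. (\<lambda>(b, v). (\<lambda>x\<in>dyadic. inv_into (carrier \<Gamma>) \<beta> (b x \<otimes>\<^bsub>\<Gamma>'\<^esub> inv\<^bsub>\<Gamma>'\<^esub> c (e v x)), v)) (\<Phi> X) = X"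
      by (auto simp: A.carrier_G \<Phi>_def B.m_assoc 2 intro!: A.K_eqI A.K_memI)
    show "\<forall>X\<in>carrier B.G. \<Phi> ((\<lambda>(b, v). (\<lambda>x\<in>dyadic. inv_into (carrier \<Gamma>) \<beta> (b x \<otimes>\<^bsub>\<Gamma>'\<^esub> inv\<^bsub>\<Gamma>'\<^esub> c (e v x)), v)) X) = X"
      by (auto simp: B.carrier_G \<Phi>_def B.m_assoc 1 intro!: B.K_eqI B.K_memI)
  qed
  ultimately show ?thesis unfolding is_iso_def iso_def by blast
qed

section \<open>Homomorphisms onto V kill K\<close>

text \<open>If \<open>f\<close> moves \<open>x\<close>, then by injectivity it also moves
  \<open>f x\<close>, so \<open>g\<close> fixes both points and either composite gives
  \<open>f x\<close>.\<close>

lemma inj_disjoint_commute: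
  assumes "inj f" "inj g" "\<And>x. f x = x \<or> g x = x" shows "f \<circ> g = g \<circ> f"
proof
  fix x
  show "(f \<circ> g) x = (g \<circ> f) x"
    using assms by (metis comp_apply injD)
qed

definition (in monoid) comm :: "'a \<Rightarrow> 'a \<Rightarrow> 'a" where
  "comm x y = x \<otimes> y \<otimes> inv x \<otimes> inv y"

context group
begin

lemma comm_closed [simp, intro]: "x \<in> carrier G \<Longrightarrow> y \<in> carrier G \<Longrightarrow> comm x y \<in> carrier G"
  by (simp add: comm_def)

lemma inv_comm: "x \<in> carrier G \<Longrightarrow> y \<in> carrier G \<Longrightarrow> inv (comm x y) = comm y x"
  by (simp add: comm_def inv_mult_group m_assoc)

lemma comm_one_iff:
  assumes "x \<in> carrier G" "y \<in> carrier G" shows "comm x y = \<one> \<longleftrightarrow> x \<otimes> y = y \<otimes> x"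
  using assms by (simp add: comm_def inv_solve_right' flip: m_assoc)

text \<open>\<open>comm f a\<close> is \<open>f\<close> times the inverse of
  \<open>a \<otimes> f \<otimes> inv a\<close>, and the second factor drops out of a commutator with
  \<open>g\<close>. Hence \<open>f\<close> can be replaced by \<open>comm f a\<close>, which lies in
  every normal subgroup containing \<open>a\<close>, at no cost.\<close>

lemma comm_comm_eq:
  assumes [simp]: "f \<in> carrier G" "a \<in> carrier G" "g \<in> carrier G"
    and c: "(a \<otimes> f \<otimes> inv a) \<otimes> g = g \<otimes> (a \<otimes> f \<otimes> inv a)"
  shows "comm (comm f a) g = comm f g"
proof -
  define p where "p = a \<otimes> f \<otimes> inv a"
  have [simp]: "p \<in> carrier G" by (simp add: p_def)
  have "comm f a = f \<otimes> inv p"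
    by (simp add: comm_def p_def inv_mult_group m_assoc)
  then have "comm (comm f a) g = f \<otimes> inv p \<otimes> (g \<otimes> p) \<otimes> inv f \<otimes> inv g"
    by (simp add: comm_def inv_mult_group m_assoc)
  also have "g \<otimes> p = p \<otimes> g" using c by (simp add: p_def)
  also have "f \<otimes> inv p \<otimes> (p \<otimes> g) \<otimes> inv f \<otimes> inv g = comm f g"
    by (simp add: comm_def m_assoc inv_solve_left')
  finally show ?thesis .
qed

end

lemma (in group_hom) hom_comm:
  "x \<in> carrier G \<Longrightarrow> y \<in> carrier G \<Longrightarrow> h (G.comm x y) = H.comm (h x) (h y)"
  by (simp add: G.comm_def H.comm_def)

lemma carrier_V [simp]: "carrier thompsonV = thompsonV_set"
  by (simp add: thompsonV_def)

lemma mult_V [simp]: "f \<otimes>\<^bsub>thompsonV\<^esub> g = f \<circ> g"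
  by (simp add: thompsonV_def)

lemma one_V [simp]: "\<one>\<^bsub>thompsonV\<^esub> = id"
  by (simp add: thompsonV_def)

lemma group_V: "group thompsonV"
  by (rule groupI) (auto simp: o_assoc intro: bexI[of _ "hinv _"] V_inv_comp)

lemma inv_V: "f \<in> thompsonV_set \<Longrightarrow> inv\<^bsub>thompsonV\<^esub> f = hinv f"
  using group.inv_equality[OF group_V, of "hinv f" f] by (simp add: V_inv_comp)

abbreviation Vcomm where "Vcomm \<equiv> monoid.comm thompsonV"

lemma Vcomm_eq: "f \<in> thompsonV_set \<Longrightarrow> g \<in> thompsonV_set \<Longrightarrow> Vcomm f g = f \<circ> g \<circ> hinv f \<circ> hinv g"
  using group.is_monoid[OF group_V] by (simp add: monoid.comm_def inv_V)

lemma Vcomm_closed [simp]: "f \<in> thompsonV_set \<Longrightarrow> g \<in> thompsonV_set \<Longrightarrow> Vcomm f g \<in> thompsonV_set"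
  using group.comm_closed[OF group_V] by simp

lemma Vcomm_fix:
  "f \<in> thompsonV_set \<Longrightarrow> g \<in> thompsonV_set \<Longrightarrow> f x = x \<Longrightarrow> g x = x \<Longrightarrow> Vcomm f g x = x"
  using V_inv_f[of f x] V_inv_f[of g x] by (simp add: Vcomm_eq)

text \<open>Since \<open>a\<close> moves \<open>I\<close> off itself, the conjugate of
  \<open>f\<close> by \<open>a\<close> is the identity on \<open>I\<close> and therefore commutes
  with \<open>g\<close>.\<close>

lemma Vcomm_double_eq:
  assumes f: "f \<in> thompsonV_set" and g: "g \<in> thompsonV_set" and a: "a \<in> thompsonV_set"
    and move: "\<And>z. z \<in> I \<Longrightarrow> a z \<notin> I"
    and fix_off: "\<And>z. z \<notin> I \<Longrightarrow> f z = z" "\<And>z. z \<notin> I \<Longrightarrow> g z = z"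
  shows "Vcomm (Vcomm f a) g = Vcomm f g"
proof (rule group.comm_comm_eq[OF group_V])
  have "(a \<circ> f \<circ> hinv a) z = z \<or> g z = z" for z
  proof (cases "z \<in> I")
    case True
    then have "hinv a z \<notin> I" using move[of "hinv a z"] a by auto
    then show ?thesis using fix_off(1) a by simp
  qed (use fix_off in blast)
  moreover have "a \<circ> f \<circ> hinv a \<in> thompsonV_set" using a f by simp
  ultimately have "(a \<circ> f \<circ> hinv a) \<circ> g = g \<circ> (a \<circ> f \<circ> hinv a)"
    by (intro inj_disjoint_commute) (auto intro: V_bij[THEN bij_is_inj] g)
  then show "(a \<otimes>\<^bsub>thompsonV\<^esub> f \<otimes>\<^bsub>thompsonV\<^esub> inv\<^bsub>thompsonV\<^esub> a) \<otimes>\<^bsub>thompsonV\<^esub> g =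
    g \<otimes>\<^bsub>thompsonV\<^esub> (a \<otimes>\<^bsub>thompsonV\<^esub> f \<otimes>\<^bsub>thompsonV\<^esub> inv\<^bsub>thompsonV\<^esub> a)"
    using a by (simp add: inv_V)
qed (use assms in auto)

lemma hinv_swp: "indep u w \<Longrightarrow> hinv (swp u w) = swp u w"
  by (rule inv_equality) simp_all

lemma swp_third: "indep a c \<Longrightarrow> indep b c \<Longrightarrow> swp a b (pre c y) = pre c y"
  using pre_in_cone by (intro swp_other) (fastforce simp: indep_def)+

text \<open>The double commutators of the transpositions (1 2), (1 3), (1 4) of four subcones are two distinct
  3-cycles that do not commute, so the second derived group of a rigid stabilizer is nontrivial.\<close>
lemma second_commutator_nontrivial:
  fixes u :: "bool list"
  defines "s12 \<equiv> swp (u @ [False, False]) (u @ [False, True])"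
    and "s13 \<equiv> swp (u @ [False, False]) (u @ [True, False])"
    and "s14 \<equiv> swp (u @ [False, False]) (u @ [True, True])"
  shows "\<exists>y\<in>cone u. Vcomm (Vcomm s12 s13) (Vcomm s12 s14) y \<noteq> y"
proof
  let ?y = "pre (u @ [False, False]) zeros"
  have V [simp]: "s12 \<in> thompsonV_set" "s13 \<in> thompsonV_set" "s14 \<in> thompsonV_set"
    by (simp_all add: s12_def s13_def s14_def)
  have i: "hinv (Vcomm f g) = Vcomm g f" if "f \<in> thompsonV_set" "g \<in> thompsonV_set" for f g
    using group.inv_comm[OF group_V, of f g] that by (simp add: inv_V)
  have inv: "hinv s12 = s12" "hinv s13 = s13" "hinv s14 = s14"
    by (simp_all add: s12_def s13_def s14_def hinv_swp)
  have eq: "Vcomm (Vcomm s12 s13) (Vcomm s12 s14) ?y = pre (u @ [False, True]) zeros"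
    by (simp add: Vcomm_eq[of "Vcomm s12 s13" "Vcomm s12 s14"] i)
      (simp add: Vcomm_eq inv, simp add: s12_def s13_def s14_def swp_third)
  show "Vcomm (Vcomm s12 s13) (Vcomm s12 s14) ?y \<noteq> ?y"
  proof
    assume "Vcomm (Vcomm s12 s13) (Vcomm s12 s14) ?y = ?y"
    then have "pre (u @ [False, True]) zeros = ?y" using eq by simp
    then have "?y \<in> cone (u @ [False, True])" using pre_in_cone by metis
    then show False by (simp add: pre_append) (simp add: cone_def zeros_def)
  qed
  show "?y \<in> cone u" using cone_append_subset pre_in_cone by blast
qed

section \<open>A homomorphism onto \<open>V\<close>, restricted to \<open>K\<close>\<close>

context twisted
begin

lemma K_embed_hom: "(\<lambda>a. (a, id)) \<in> hom K G"
  by (rule homI) (auto simp: carrier_G G_mult twist_id)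

lemma K_embed_group_hom: "group_hom K G (\<lambda>a. (a, id))"
  using K_embed_hom K_group G_group by (simp add: group_hom_def group_hom_axioms_def)

lemma snd_group_hom: "group_hom G thompsonV snd"
proof -
  have "snd \<in> hom G thompsonV" by (rule homI) (auto simp: carrier_G snd_mult)
  then show ?thesis using G_group group_V by (simp add: group_hom_def group_hom_axioms_def)
qed

lemma trivial_off_comm:
  assumes "trivial_off a I" "b \<in> carrier K"
  shows "trivial_off (monoid.comm K a b) I" "trivial_off (monoid.comm K b a) I"
proof -
  interpret Kg: group K by (rule K_group)
  show "trivial_off (Kg.comm a b) I" "trivial_off (Kg.comm b a) I"
    using assms by (auto simp: trivial_off_def Kg.comm_def)
qed

lemma trivial_off_commute:
  assumes "trivial_off a I" "trivial_off b J" "I \<inter> J = {}"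
  shows "a \<otimes>\<^bsub>K\<^esub> b = b \<otimes>\<^bsub>K\<^esub> a"
proof -
  interpret Kg: group K by (rule K_group)
  show ?thesis
  proof (rule K_eqI)
    fix x assume x: "x \<in> dyadic"
    have "a x = \<one> \<or> b x = \<one>" using assms x unfolding trivial_off_def by blast
    then show "(a \<otimes>\<^bsub>K\<^esub> b) x = (b \<otimes>\<^bsub>K\<^esub> a) x" using x assms by (auto simp: trivial_off_def)
  qed (use assms in \<open>auto simp: trivial_off_def\<close>)
qed

lemma trivial_off_act:
  assumes "trivial_off a I" "X \<in> carrier G"
  shows "trivial_off (act X a) (snd X ` I)"
proof -
  have v: "snd X \<in> thompsonV_set" and a: "a \<in> carrier K"
    using assms by (auto simp: carrier_G trivial_off_def)
  have "act X a y = \<one>" if "y \<in> dyadic - snd X ` I" for y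
  proof -
    define x where "x = hinv (snd X) y"
    have x: "x \<in> dyadic" "y = snd X x" using that v by (simp_all add: x_def)
    then have "x \<notin> I" using that by blast
    then have "a x = \<one>" using assms(1) x by (simp add: trivial_off_def)
    then show ?thesis using act_one_iff[OF assms(2) a x(1)] x by simp
  qed
  then show ?thesis using a assms(2) by (auto simp: trivial_off_def)
qed

context
  fixes \<tau>
  assumes tau: "\<tau> \<in> hom G thompsonV" and surj: "\<tau> ` carrier G = thompsonV_set"
begin

interpretation Kg: group K by (rule K_group)
interpretation Gg: group G by (rule G_group)
interpretation T: group_hom G thompsonV \<tau>
  using tau G_group group_V by (simp add: group_hom_def group_hom_axioms_def)
interpretation E: group_hom K G "\<lambda>a. (a, id)" by (rule K_embed_group_hom)
interpretation S: group_hom G thompsonV snd by (rule snd_group_hom)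

lemma tau_V [simp]: "X \<in> carrier G \<Longrightarrow> \<tau> X \<in> thompsonV_set"
  using T.hom_closed by simp

lemma tau_lift: "v \<in> thompsonV_set \<Longrightarrow> \<exists>X\<in>carrier G. \<tau> X = v"
  using surj by (metis imageE)

lemma tau_act: "X \<in> carrier G \<Longrightarrow> a \<in> carrier K \<Longrightarrow> \<tau> (act X a, id) = \<tau> X \<circ> \<tau> (a, id) \<circ> hinv (\<tau> X)"
proof -
  assume X: "X \<in> carrier G" and a: "a \<in> carrier K"
  have m: "(a, id) \<in> carrier G" "(act X a, id) \<in> carrier G" using X a by (auto simp: carrier_G)
  then have "\<tau> X \<circ> \<tau> (a, id) = \<tau> (act X a, id) \<circ> \<tau> X"
    using arg_cong[OF act_conj[OF X a], of \<tau>] X by simp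
  then show ?thesis using X by (simp add: o_assoc[symmetric] V_inv_comp)
qed

text \<open>Normality of \<open>K\<close>: however \<open>X\<close> and \<open>Y\<close> were chosen
  as lifts, a double commutator involving \<open>a\<close> has trivial \<open>V\<close>-part. This
  is how commutators of prescribed elements of \<open>V\<close> become images of elements of
  \<open>K\<close>.\<close>

lemma K_comm_lift:
  assumes "X \<in> carrier G" "Y \<in> carrier G" "a \<in> carrier K"
  obtains d where "d \<in> carrier K" "\<tau> (d, id) = Vcomm (Vcomm (\<tau> X) (\<tau> (a, id))) (\<tau> Y)"
proof -
  have a: "(a, id) \<in> carrier G" using assms by (simp add: carrier_G)
  define D where "D = Gg.comm (Gg.comm X (a, id)) Y"
  have D: "D \<in> carrier G" using assms a by (simp add: D_def)
  have sV: "snd X \<in> thompsonV_set" "snd Y \<in> thompsonV_set" using assms by (auto simp: carrier_G)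
  have "snd D = Vcomm (Vcomm (snd X) id) (snd Y)"
    using assms a S.hom_comm by (simp add: D_def)
  also have "\<dots> = id" using sV by (simp add: Vcomm_eq V_inv_comp inv_id)
  finally have "D = (fst D, id)" by (metis prod.collapse)
  moreover have "\<tau> D = Vcomm (Vcomm (\<tau> X) (\<tau> (a, id))) (\<tau> Y)"
    using assms a T.hom_comm by (simp add: D_def)
  ultimately show ?thesis using that[of "fst D"] D by (simp add: carrier_G mem_Times_iff)
qed

text \<open>If both images moved \<open>x\<close>, both would move a whole cone \<open>u\<close> off
  itself. Two rounds of the double commutator argument then produce \<open>e\<close>, trivial off
  \<open>I\<close>, whose image lives on \<open>cone u\<close> and is not the identity. As
  \<open>e\<close> commutes with \<open>b\<close>, its image would also have to act on the disjoint
  image of that cone under \<open>\<tau> (b, id)\<close>. Two rounds are needed because lifts of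
  swaps need not respect \<open>I\<close>: the first brings the commutators into \<open>K\<close>,
  and only elements of \<open>K\<close> preserve \<open>trivial_off\<close> in the second.\<close>

lemma tau_disjoint_moved:
  assumes a: "trivial_off a I" and b: "trivial_off b J" and IJ: "I \<inter> J = {}"
    and am: "\<tau> (a, id) x \<noteq> x"
  shows "\<tau> (b, id) x = x"
proof (rule ccontr)
  assume bm: "\<tau> (b, id) x \<noteq> x"
  have aK: "a \<in> carrier K" and bK: "b \<in> carrier K" using a b by (auto simp: trivial_off_def)
  then have aG: "(a, id) \<in> carrier G" and bG: "(b, id) \<in> carrier G" by (auto simp: carrier_G)
  obtain n where n: "\<And>m z. m \<ge> n \<Longrightarrow> z \<in> cone (pfx x m) \<Longrightarrow> \<tau> (a, id) z \<notin> cone (pfx x m)"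
    using V_move_cone[OF tau_V[OF aG] am] by metis
  obtain n' where n': "\<And>m z. m \<ge> n' \<Longrightarrow> z \<in> cone (pfx x m) \<Longrightarrow> \<tau> (b, id) z \<notin> cone (pfx x m)"
    using V_move_cone[OF tau_V[OF bG] bm] by metis
  define u where "u = pfx x (max n n')"
  have ua: "\<tau> (a, id) z \<notin> cone u" and ub: "\<tau> (b, id) z \<notin> cone u" if "z \<in> cone u" for z
    using n n' that by (simp_all add: u_def)
  define s12 where "s12 = swp (u @ [False, False]) (u @ [False, True])"
  define s13 where "s13 = swp (u @ [False, False]) (u @ [True, False])"
  define s14 where "s14 = swp (u @ [False, False]) (u @ [True, True])"
  have V [simp]: "s12 \<in> thompsonV_set" "s13 \<in> thompsonV_set" "s14 \<in> thompsonV_set"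
    by (simp_all add: s12_def s13_def s14_def)
  have sub: "cone (u @ w) \<subseteq> cone u" for w by (rule cone_append_subset)
  have off: "s12 z = z" "s13 z = z" "s14 z = z" if "z \<notin> cone u" for z
    unfolding s12_def s13_def s14_def using that sub by (blast intro: swp_other)+
  obtain X12 X13 X14 where X: "X12 \<in> carrier G" "X13 \<in> carrier G" "X14 \<in> carrier G"
    and tX: "\<tau> X12 = s12" "\<tau> X13 = s13" "\<tau> X14 = s14"
    using tau_lift[OF V(1)] tau_lift[OF V(2)] tau_lift[OF V(3)] by blast
  obtain d where d: "d \<in> carrier K" "\<tau> (d, id) = Vcomm s12 s13"
    using K_comm_lift[OF X(1,2) aK] Vcomm_double_eq[OF V(1,2) tau_V[OF aG] ua off(1,2)] tX
    by metis
  obtain d' where d': "d' \<in> carrier K" "\<tau> (d', id) = Vcomm s12 s14"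
    using K_comm_lift[OF X(1,3) aK] Vcomm_double_eq[OF V(1,3) tau_V[OF aG] ua off(1,3)] tX
    by metis
  have off': "Vcomm s12 s13 z = z" "Vcomm s12 s14 z = z" if "z \<notin> cone u" for z
    using off[OF that] by (simp_all add: Vcomm_fix)
  \<comment> \<open>Trivial off \<open>I\<close> because \<open>a\<close> is and \<open>d\<close>,
    \<open>d'\<close> lie in \<open>K\<close>; its image is the second commutator
    \<open>Vcomm (Vcomm s12 s13) (Vcomm s12 s14)\<close>, unaffected by the insertion of
    \<open>a\<close>.\<close>
  define e where "e = Kg.comm (Kg.comm d a) d'"
  have e: "trivial_off e I" unfolding e_def using a d d' trivial_off_comm by metis
  have eK: "e \<in> carrier K" using e by (simp add: trivial_off_def)
  have "(e, id) = Gg.comm (Gg.comm (d, id) (a, id)) (d', id)"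
    unfolding e_def using aK d d' E.hom_comm by simp
  then have "\<tau> (e, id) = Vcomm (Vcomm (\<tau> (d, id)) (\<tau> (a, id))) (\<tau> (d', id))"
    using T.hom_comm aG d(1) d'(1) E.hom_closed by simp
  then have "\<tau> (e, id) = Vcomm (Vcomm s12 s13) (Vcomm s12 s14)"
    using d d' Vcomm_double_eq[OF _ _ tau_V[OF aG] ua off'] by simp
  then obtain y where y: "y \<in> cone u" "\<tau> (e, id) y \<noteq> y"
    using second_commutator_nontrivial[of u] by (auto simp: s12_def s13_def s14_def)
  have "(e, id) \<otimes>\<^bsub>G\<^esub> (b, id) = (b, id) \<otimes>\<^bsub>G\<^esub> (e, id)"
    by (simp only: G_mult twist_id[OF eK] twist_id[OF bK] trivial_off_commute[OF e b IJ])
  then have "\<tau> (e, id) \<circ> \<tau> (b, id) = \<tau> (b, id) \<circ> \<tau> (e, id)"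
    using T.hom_mult[of "(e, id)" "(b, id)"] T.hom_mult[of "(b, id)" "(e, id)"] bG eK E.hom_closed by simp
  then have "\<tau> (e, id) (\<tau> (b, id) y) = \<tau> (b, id) (\<tau> (e, id) y)" by (rule comp_eq_dest)
  moreover have "\<tau> (e, id) (\<tau> (b, id) y) = \<tau> (b, id) y"
    using \<open>\<tau> (e, id) = Vcomm (Vcomm s12 s13) (Vcomm s12 s14)\<close> off'[OF ub[OF y(1)]]
    by (simp add: Vcomm_fix)
  ultimately show False using y(2) tau_V[OF bG] by simp
qed

text \<open>A copy \<open>b\<close> of \<open>a\<close> on the other half moves some point
  \<open>q\<close>, so every element of the first half has an image fixing \<open>q\<close>. But
  \<open>\<tau> (a, id)\<close> moves \<open>x\<close>, and a conjugation inside \<open>K\<close>,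
  which preserves the first half, can transport \<open>x\<close> to \<open>q\<close>.\<close>

lemma tau_half_trivial:
  assumes a: "trivial_off a (cone [False])" shows "\<tau> (a, id) = id"
proof (rule ccontr)
  assume "\<tau> (a, id) \<noteq> id"
  have aK: "a \<in> carrier K" using a by (simp add: trivial_off_def)
  then have aG: "(a, id) \<in> carrier G" by (simp add: carrier_G)
  obtain x where x: "x \<in> dyadic" "\<tau> (a, id) x \<noteq> x"
    using V_eq_idI[OF tau_V[OF aG]] \<open>\<tau> (a, id) \<noteq> id\<close> by blast
  define X where "X = (\<one>\<^bsub>K\<^esub>, swp [False] [True])"
  have X: "X \<in> carrier G" by (simp add: X_def carrier_G)
  define b where "b = act X a"
  have "snd X ` cone [False] \<subseteq> cone [True]"
    by (auto simp: X_def elim!: in_coneE)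
  then have b: "trivial_off b (cone [True])"
    using trivial_off_act[OF a X] unfolding b_def trivial_off_def by blast
  have disj: "cone [False] \<inter> cone [True] = {}" by (auto simp: cone_def)
  define q where "q = \<tau> X x"
  have q: "q \<in> dyadic" using x X by (simp add: q_def)
  have bq: "\<tau> (b, id) q \<noteq> q" using tau_act[OF X aK] x X aG by (simp add: b_def q_def)
  have no: "\<tau> (c, id) q = q" if "trivial_off c (cone [False])" for c
    using tau_disjoint_moved[OF that b disj] bq by blast
  define r where "r = \<tau> (a, id) x"
  have r: "r \<in> dyadic" "r \<noteq> x" using x aG by (simp_all add: r_def)
  have "\<tau> (a, id) r \<noteq> r" using x aG by (simp add: r_def)
  then have "r \<noteq> q" "x \<noteq> q" using no[OF a] x by auto
  obtain u w where uw: "indep u w" "x \<notin> cone u" "x \<notin> cone w" "swp u w r = q"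
    using swap_dyadic[OF r(1) q \<open>r \<noteq> q\<close>, of x] r(2) \<open>x \<noteq> q\<close> by metis
  obtain W where W: "W \<in> carrier G" "\<tau> W = swp u w"
    using tau_lift[OF swp_V[OF uw(1)]] by blast
  \<comment> \<open>\<open>k\<close> need not be trivial off a half; what matters is that it lies in
    \<open>K\<close>. Its image takes \<open>x\<close> to \<open>q\<close>, because the conjugating
    swap fixes \<open>x\<close> and sends \<open>r\<close> to \<open>q\<close>.\<close>
  define k where "k = act W a"
  have kK: "k \<in> carrier K" using W aK by (simp add: k_def)
  then have kG: "(k, id) \<in> carrier G" by (simp add: carrier_G)
  have kx: "\<tau> (k, id) x = q"
    using tau_act[OF W(1) aK] W uw by (simp add: k_def hinv_swp swp_other r_def)
  define c where "c = act (k, id) a"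
  have "trivial_off c (cone [False])" using trivial_off_act[OF a kG] by (simp add: c_def)
  then have "\<tau> (c, id) q = q" by (rule no)
  moreover have "hinv (\<tau> (k, id)) q = x" using kx tau_V[OF kG] V_inv_f by metis
  then have "\<tau> (c, id) q = \<tau> (k, id) (\<tau> (a, id) x)"
    using tau_act[OF kG aK] by (simp add: c_def)
  ultimately show False using kx x(2) tau_V[OF kG] by (metis V_eq_iff)
qed

lemma tau_K_trivial:
  assumes a: "a \<in> carrier K" shows "\<tau> (a, id) = id"
proof -
  define a0 where "a0 = (\<lambda>x\<in>dyadic. if x \<in> cone [False] then a x else \<one>)"
  define a1 where "a1 = (\<lambda>x\<in>dyadic. if x \<in> cone [False] then \<one> else a x)"
  have 0: "trivial_off a0 (cone [False])" and 1: "trivial_off a1 (cone [True])"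
    using a by (auto simp: trivial_off_def a0_def a1_def cone_def intro!: K_memI)
  then have K: "a0 \<in> carrier K" "a1 \<in> carrier K" by (auto simp: trivial_off_def)
  have a_eq: "a = a0 \<otimes>\<^bsub>K\<^esub> a1"
    by (rule K_eqI) (use a K in \<open>auto simp: a0_def a1_def\<close>)
  define X where "X = (\<one>\<^bsub>K\<^esub>, swp [False] [True])"
  have X: "X \<in> carrier G" by (simp add: X_def carrier_G)
  have "snd X ` cone [True] \<subseteq> cone [False]"
    by (auto simp: X_def elim!: in_coneE)
  then have "trivial_off (act X a1) (cone [False])"
    using trivial_off_act[OF 1 X] unfolding trivial_off_def by blast
  then have "\<tau> X \<circ> \<tau> (a1, id) \<circ> hinv (\<tau> X) = id"
    using tau_half_trivial tau_act[OF X K(2)] by metis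
  then have "\<tau> X (\<tau> (a1, id) (hinv (\<tau> X) (\<tau> X z))) = \<tau> X z" for z by (metis comp_apply id_apply)
  then have "\<tau> (a1, id) z = id z" for z using X by simp
  then have "\<tau> (a1, id) = id" by blast
  moreover have "\<tau> (a0, id) = id" by (rule tau_half_trivial[OF 0])
  moreover have "(a, id) = (a0, id) \<otimes>\<^bsub>G\<^esub> (a1, id)"
    by (simp only: G_mult twist_id[OF K(2)] id_comp flip: a_eq)
  ultimately show ?thesis
    using T.hom_mult[of "(a0, id)" "(a1, id)"] E.hom_closed[OF K(1)] E.hom_closed[OF K(2)] by simp
qed

end

end

section \<open>Slopes under equivariant bijections\<close>

lemma V_funpow: "f \<in> thompsonV_set \<Longrightarrow> f ^^ n \<in> thompsonV_set"
  by (induction n) (auto simp: V_id[unfolded id_def])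

lemma log2_slope_funpow:
  assumes "f \<in> thompsonV_set" "f x = x"
  shows "log2_slope (f ^^ n) x = int n * log2_slope f x"
proof (induction n)
  case 0
  then show ?case by (simp add: log2_slope_id[unfolded id_def] id_def)
next
  case (Suc n)
  have "(f ^^ n) x = x" by (induction n) (use assms in auto)
  then have "log2_slope (f \<circ> f ^^ n) x = log2_slope f x + int n * log2_slope f x"
    using Suc assms log2_slope_comp[OF assms(1) V_funpow[OF assms(1)]] by simp
  then show ?case by (simp only: funpow.simps(2)) (simp add: algebra_simps)
qed

text \<open>A word \<open>0y\<close> goes first to \<open>1y\<close> and then to \<open>00y\<close>,
  so this element fixes \<open>zeros\<close> and halves distances there; its germ generates all
  germs fixing \<open>zeros\<close>. The twisted action carries the negated exponent, so on the
  factor at \<open>zeros\<close> it acts by \<open>\<alpha>\<close> itself.\<close>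

definition contraction :: "cantor \<Rightarrow> cantor" where
  "contraction = swp [False, False] [True] \<circ> swp [False] [True]"

lemma contraction_V [simp]: "contraction \<in> thompsonV_set"
  by (simp add: contraction_def)

lemma contraction_False [simp]: "contraction (pre [False] y) = pre [False, False] y"
  by (simp add: contraction_def)

lemma contraction_zeros [simp]: "contraction zeros = zeros"
  using contraction_False[of zeros] pre_append[of "[False]" "[False]" zeros] by simp

lemma log2_slope_contraction [simp]: "log2_slope contraction zeros = - 1"
proof -
  have "zeros \<in> cone [False]" by (simp add: cone_def zeros_def)
  then have "loc contraction zeros (length [False]) (length [False, False])" by (rule locI) simp
  then show ?thesis by (simp add: log2_slope_loc)
qed

text \<open>Makes every cone the exact set of moved points of an element of \<open>V\<close>, so
  that cones, hence neighbourhoods, can be expressed through the permutation action.\<close>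

lemma swp_halves_moves_iff: "swp (q @ [False]) (q @ [True]) x \<noteq> x \<longleftrightarrow> x \<in> cone q"
proof
  assume "swp (q @ [False]) (q @ [True]) x \<noteq> x"
  then show "x \<in> cone q" using swp_other cone_append_subset by blast
next
  assume "x \<in> cone q"
  then obtain y where "x = pre q y" by (rule in_coneE)
  moreover have "y \<in> cone [False] \<or> y \<in> cone [True]" by (auto simp: cone_def)
  ultimately have "x \<in> cone (q @ [False]) \<union> cone (q @ [True])" by simp
  then show "swp (q @ [False]) (q @ [True]) x \<noteq> x" by (intro swp_moves) simp_all
qed

locale equivariant_bijection =
  fixes \<psi> :: "(cantor \<Rightarrow> cantor) \<Rightarrow> (cantor \<Rightarrow> cantor)" and \<phi> :: "cantor \<Rightarrow> cantor"
  assumes psi_bij: "bij_betw \<psi> thompsonV_set thompsonV_set"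
    and psi_comp: "\<And>v w. v \<in> thompsonV_set \<Longrightarrow> w \<in> thompsonV_set \<Longrightarrow> \<psi> (v \<circ> w) = \<psi> v \<circ> \<psi> w"
    and phi_bij: "bij_betw \<phi> dyadic dyadic"
    and equivariant: "\<And>v x. v \<in> thompsonV_set \<Longrightarrow> x \<in> dyadic \<Longrightarrow> \<phi> (v x) = \<psi> v (\<phi> x)"
begin

lemma psi_V [simp]: "v \<in> thompsonV_set \<Longrightarrow> \<psi> v \<in> thompsonV_set"
  using psi_bij bij_betwE by blast

lemma psi_surj: "w \<in> thompsonV_set \<Longrightarrow> \<exists>v\<in>thompsonV_set. \<psi> v = w"
  using psi_bij by (metis bij_betw_imp_surj_on imageE)

lemma phi_dyadic [simp]: "x \<in> dyadic \<Longrightarrow> \<phi> x \<in> dyadic"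
  using phi_bij bij_betwE by blast

lemma phi_eq_iff: "x \<in> dyadic \<Longrightarrow> y \<in> dyadic \<Longrightarrow> \<phi> x = \<phi> y \<longleftrightarrow> x = y"
  using phi_bij by (metis bij_betw_imp_inj_on inj_onD)

lemma phi_surj: "y \<in> dyadic \<Longrightarrow> \<exists>x\<in>dyadic. \<phi> x = y"
  using phi_bij by (metis bij_betw_imp_surj_on imageE)

lemma psi_moves: "v \<in> thompsonV_set \<Longrightarrow> x \<in> dyadic \<Longrightarrow> \<psi> v (\<phi> x) \<noteq> \<phi> x \<longleftrightarrow> v x \<noteq> x"
  using equivariant[of v x] phi_eq_iff[of "v x" x] by simp

text \<open>A germ is trivial iff the element fixes the moved points of some element that moves the base
  point, a property visible in the permutation action.\<close>
lemma psi_slope0: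
  assumes v: "v \<in> thompsonV_set" and x: "x \<in> dyadic" "v x = x" "log2_slope v x = 0"
  shows "log2_slope (\<psi> v) (\<phi> x) = 0"
proof -
  obtain m where m: "\<And>z. z \<in> cone (pfx x m) \<Longrightarrow> v z = z"
    using V_slope0_local_id[OF v x(2,3)] by blast
  define q where "q = pfx x m"
  define f where "f = swp (q @ [False]) (q @ [True])"
  have f: "f \<in> thompsonV_set" by (simp add: f_def)
  have "f x \<noteq> x" unfolding f_def swp_halves_moves_iff by (simp add: q_def)
  then have "\<psi> f (\<phi> x) \<noteq> \<phi> x" using psi_moves f x by simp
  then obtain n where n: "\<And>m z. m \<ge> n \<Longrightarrow> z \<in> cone (pfx (\<phi> x) m) \<Longrightarrow> \<psi> f z \<notin> cone (pfx (\<phi> x) m)"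
    using V_move_cone[OF psi_V[OF f]] by metis
  have "\<psi> v z = z" if z: "z \<in> cone (pfx (\<phi> x) n)" "z \<in> dyadic" for z
  proof -
    obtain y where y: "y \<in> dyadic" "z = \<phi> y" using phi_surj z(2) by blast
    have "\<psi> f z \<noteq> z" using n[of n z] z(1) by auto
    then have "f y \<noteq> y" using psi_moves f y by simp
    then have "v y = y" unfolding f_def swp_halves_moves_iff using m by (simp add: q_def)
    then show ?thesis using psi_moves v y by metis
  qed
  then show ?thesis using V_dyadic_local_id[OF psi_V[OF v]] in_cone_pfx by blast
qed

text \<open>Points near \<open>zeros\<close> stay near it under the contraction, so their images
  under \<open>\<phi>\<close> stay in a cone around \<open>y0\<close>. With slope 2 the map
  \<open>g\<close> would delete one letter \<open>False\<close> behind \<open>q\<close> at each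
  step; staying in the cone forever then forces every letter to be \<open>False\<close>, leaving
  only \<open>y0\<close> itself.\<close>

lemma psi_contraction_slope_not_1: "log2_slope (\<psi> contraction) (\<phi> zeros) \<noteq> 1"
proof
  define g where "g = \<psi> contraction"
  define y0 where "y0 = \<phi> zeros"
  assume "log2_slope (\<psi> contraction) (\<phi> zeros) = 1"
  then have s: "log2_slope g y0 = 1" by (simp add: g_def y0_def)
  have g: "g \<in> thompsonV_set" by (simp add: g_def)
  have gy: "g y0 = y0" using equivariant[of contraction zeros] by (simp add: g_def y0_def)
  have y0: "y0 \<in> dyadic" by (simp add: y0_def)
  obtain a b where ab: "loc g y0 a b" using g by (rule V_locE)
  have "a = b + 1" using s log2_slope_loc[OF ab] by simp
  obtain N where N: "\<And>n. n \<ge> N \<Longrightarrow> pre (pfx y0 n) zeros = y0"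
    using dyadic_pre_zeros[OF y0] by metis
  define q where "q = pfx y0 (b + N)"
  have qz: "pre q zeros = y0" using N by (simp add: q_def)
  have qF: "pfx y0 (a + N) = q @ [False]"
    using pfx_pre[of "q @ [False]" zeros] qz \<open>a = b + 1\<close> by (simp add: pre_append q_def)
  have gq: "g (pre (q @ [False]) z) = pre q z" for z
    using loc_add[OF ab, of N] qF gy unfolding loc_def by (simp add: q_def)
  \<comment> \<open>The cone around \<open>y0\<close> is the moved set of \<open>\<psi> f\<close>.
    Pulled back, it contains a cone around \<open>zeros\<close> since \<open>f\<close> moves
    \<open>zeros\<close>.\<close>
  obtain f where f: "f \<in> thompsonV_set" "\<psi> f = swp ((q @ [False]) @ [False]) ((q @ [False]) @ [True])"
    using psi_surj[OF swp_V[of "(q @ [False]) @ [False]" "(q @ [False]) @ [True]"]] by auto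
  have moves: "f x \<noteq> x \<longleftrightarrow> \<phi> x \<in> cone (q @ [False])" if "x \<in> dyadic" for x
    using psi_moves[OF f(1) that] unfolding f(2) swp_halves_moves_iff by simp
  have "y0 \<in> cone (q @ [False])" using qF in_cone_pfx by metis
  then have "f zeros \<noteq> zeros" using moves by (simp add: y0_def)
  then obtain k where k: "\<And>m z. m \<ge> k \<Longrightarrow> z \<in> cone (pfx zeros m) \<Longrightarrow> f z \<notin> cone (pfx zeros m)"
    using V_move_cone[OF f(1)] by metis
  \<comment> \<open>An orbit of the contraction inside that cone: each step inserts one more
    \<open>False\<close> before the single \<open>True\<close>.\<close>
  define x where "x j = pre (replicate (Suc (k + j)) False) (pre [True] zeros)" for j
  have xd: "x j \<in> dyadic" for j by (simp add: x_def)
  have "x j = pre [False] (pre (replicate (k + j) False) (pre [True] zeros))" for j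
    using pre_append[of "[False]" "replicate (k + j) False"] by (simp add: x_def)
  then have "contraction (x j) = pre [False, False] (pre (replicate (k + j) False) (pre [True] zeros))" for j
    by simp
  then have x_Suc: "contraction (x j) = x (Suc j)" for j
    using pre_append[of "[False, False]" "replicate (k + j) False"] by (simp add: x_def)
  have "pfx zeros k = replicate k False" by (simp add: list_eq_iff_nth_eq zeros_def)
  moreover have "replicate (Suc (k + j)) False = replicate k False @ replicate (Suc j) False" for j
    by (metis add_Suc_right replicate_add)
  ultimately have "x j \<in> cone (pfx zeros k)" for j
    by (simp only: x_def pre_append pre_in_cone)
  then have mem: "\<phi> (x j) \<in> cone (q @ [False])" for j
    using k moves[OF xd] by (metis le_refl)
  define t where "t = tail (length q) (\<phi> (x 0))"
  have "\<phi> (x 0) \<in> cone q" using mem cone_append_subset by blast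
  then have t: "\<phi> (x 0) = pre q t" by (simp add: t_def pre_tail)
  have tail: "\<phi> (x j) = pre q (tail j t)" for j
  proof (induction j)
    case 0
    show ?case by (simp add: t tail_def)
  next
    case (Suc j)
    have "tail j t \<in> cone [False]" using mem[of j] Suc by simp
    then have "tail j t = pre [False] (tail (Suc j) t)"
      using pre_tail[of "tail j t" "[False]"] by (simp add: tail_def)
    then have "\<phi> (x j) = pre (q @ [False]) (tail (Suc j) t)" using Suc by (simp add: pre_append)
    then show ?case
      using x_Suc[of j] equivariant[OF contraction_V xd, of j] gq by (simp add: g_def)
  qed
  have "tail j t \<in> cone [False]" for j using mem[of j] tail[of j] by simp
  then have "\<not> t j" for j by (simp add: cone_def tail_def)
  then have "t = zeros" by (auto simp: zeros_def)
  then have "\<phi> (x 0) = \<phi> zeros" using t qz by (simp add: y0_def)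
  then have "x 0 = zeros" using phi_eq_iff xd by simp
  moreover have "x 0 (Suc k)" by (simp add: x_def pre_def)
  ultimately show False by (simp add: zeros_def)
qed

text \<open>Trivial germs go to trivial germs, so slopes of powers are multiplied by a constant
  \<open>m\<close>. Some element of \<open>V\<close> has log slope -1 at \<open>y0\<close> and comes
  from some \<open>v\<close>, whose germ is that of a power of the contraction or of its inverse;
  hence \<open>m\<close> divides 1, and \<open>m = 1\<close> is already excluded.\<close>

lemma psi_contraction_slope: "log2_slope (\<psi> contraction) (\<phi> zeros) = - 1"
proof -
  define y0 where "y0 = \<phi> zeros"
  define m where "m = log2_slope (\<psi> contraction) y0"
  have y0: "y0 \<in> dyadic" by (simp add: y0_def)
  have gy: "\<psi> contraction y0 = y0" using equivariant[of contraction zeros] by (simp add: y0_def)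
  obtain s where s: "s \<in> thompsonV_set" "s zeros = y0" using V_transitive y0 zeros_dyadic by blast
  \<comment> \<open>The contraction moved to \<open>y0\<close> by conjugation, which leaves the
    slope unchanged.\<close>
  define w where "w = s \<circ> contraction \<circ> hinv s"
  have w: "w \<in> thompsonV_set" using s by (simp add: w_def)
  have sy: "hinv s y0 = zeros" using s V_inv_f by metis
  have wy: "w y0 = y0" using s sy by (simp add: w_def)
  have "log2_slope (hinv s) y0 = - log2_slope s zeros" using log2_slope_inv[OF s(1), of zeros] s by simp
  then have ws: "log2_slope w y0 = - 1" using s sy by (simp add: w_def log2_slope_comp)
  obtain v where v: "v \<in> thompsonV_set" "\<psi> v = w" using psi_surj[OF w] by blast
  have vz: "v zeros = zeros" using psi_moves[of v zeros] v wy by (auto simp: y0_def)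
  define c where "c n = contraction ^^ n" for n
  have c: "c n \<in> thompsonV_set" for n by (simp add: c_def V_funpow)
  have cz: "c n zeros = zeros" for n unfolding c_def by (induction n) auto
  have cs: "log2_slope (c n) zeros = - int n" for n
    unfolding c_def by (simp add: log2_slope_funpow)
  have pcs: "log2_slope (\<psi> (c n)) y0 = int n * m" for n
  proof (induction n)
    case 0
    show ?case using psi_slope0[OF c zeros_dyadic cz, of 0] cs[of 0] by (simp add: y0_def)
  next
    case (Suc n)
    have "\<psi> (c (Suc n)) = \<psi> contraction \<circ> \<psi> (c n)"
      using psi_comp[OF contraction_V c] by (simp add: c_def)
    moreover have "\<psi> (c n) y0 = y0" using equivariant[OF c zeros_dyadic, of n] by (simp add: cz y0_def)
    ultimately have "log2_slope (\<psi> (c (Suc n))) y0 = m + int n * m"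
      using Suc c by (simp only: log2_slope_comp psi_V contraction_V m_def)
    then show ?case by (simp add: algebra_simps)
  qed
  show ?thesis
  proof (cases "0 \<le> log2_slope v zeros")
    case True
    define n where "n = nat (log2_slope v zeros)"
    have vn: "log2_slope v zeros = int n" using True by (simp add: n_def)
    have "log2_slope (v \<circ> c n) zeros = 0" using v c by (simp add: log2_slope_comp cz cs vn)
    then have "log2_slope (\<psi> (v \<circ> c n)) y0 = 0"
      using psi_slope0[of "v \<circ> c n" zeros] v c by (simp add: cz vz y0_def)
    moreover have "\<psi> (c n) y0 = y0" using equivariant[OF c zeros_dyadic, of n] by (simp add: cz y0_def)
    ultimately have "int n * m = 1"
      using v c pcs w by (simp add: psi_comp log2_slope_comp ws)
    then have "m = 1" using zmult_eq_1_iff[of "int n" m] by auto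
    then show ?thesis using psi_contraction_slope_not_1 by (simp add: m_def y0_def)
  next
    case False
    define n where "n = nat (- log2_slope v zeros)"
    have vn: "log2_slope v zeros = - int n" using False by (simp add: n_def)
    define k where "k = hinv v \<circ> c n"
    have k: "k \<in> thompsonV_set" using v c by (simp add: k_def)
    have vz': "hinv v zeros = zeros" using vz v V_inv_f by metis
    have "log2_slope (hinv v) zeros = int n" using log2_slope_inv[OF v(1), of zeros] vz vn by simp
    then have "log2_slope k zeros = 0" using v c by (simp add: k_def log2_slope_comp cz cs)
    moreover have kz: "k zeros = zeros" by (simp add: k_def cz vz')
    ultimately have "log2_slope (\<psi> k) y0 = 0" using psi_slope0[OF k] by (simp add: y0_def)
    moreover have "\<psi> k y0 = y0" using equivariant[OF k zeros_dyadic] by (simp add: kz y0_def)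
    moreover have "c n = v \<circ> k" using v by (simp add: k_def fun_eq_iff)
    then have "\<psi> (c n) = w \<circ> \<psi> k" using v k psi_comp by simp
    ultimately have "int n * m = - 1" using pcs[of n] w k by (simp add: log2_slope_comp ws)
    then have "int n * (- m) = 1" by simp
    then have "m = - 1" using zmult_eq_1_iff[of "int n" "- m"] by auto
    then show ?thesis by (simp add: m_def y0_def)
  qed
qed

end

section \<open>Isomorphisms of twisted wreath products are spatial\<close>

text \<open>\<open>b\<close> is the infinite product of all translates of \<open>a\<close> by the
  powers of \<open>v\<close>, and shifting it by \<open>v\<close> loses only the first factor. The
  product exists because \<open>K\<close> is unrestricted and the points \<open>xs n\<close> are
  distinct.\<close>

lemma (in twisted) swindle:
  assumes v: "v \<in> thompsonV_set" and xd: "\<And>n. xs n \<in> dyadic" and step: "\<And>n. v (xs n) = xs (Suc n)"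
    and inj: "inj xs" and a: "trivial_off a {xs 0}"
  shows "\<exists>b. trivial_off b (range xs) \<and> a = b \<otimes>\<^bsub>K\<^esub> inv\<^bsub>K\<^esub> (twist_action \<Gamma> \<alpha> v b)"
proof -
  interpret Kg: group K by (rule K_group)
  have aK: "a \<in> carrier K" using a by (simp add: trivial_off_def)
  \<comment> \<open>\<open>c n\<close> is the value at \<open>xs n\<close> of the
    \<open>n\<close>-th translate of \<open>a\<close>.\<close>
  define c where "c = rec_nat (a (xs 0)) (\<lambda>n. pw (- log2_slope v (xs n)))"
  have c0: "c 0 = a (xs 0)" and cS: "c (Suc n) = pw (- log2_slope v (xs n)) (c n)" for n
    by (simp_all add: c_def)
  have cc: "c n \<in> carrier \<Gamma>" for n
    by (induction n) (use aK xd in \<open>auto simp: c0 cS\<close>)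
  define b where "b = (\<lambda>y\<in>dyadic. if y \<in> range xs then c (inv_into UNIV xs y) else \<one>)"
  have bK: "b \<in> carrier K" unfolding b_def by (rule K_memI) (simp add: cc)
  have bx: "b (xs n) = c n" for n using inj xd by (simp add: b_def)
  have b1: "b y = \<one>" if "y \<in> dyadic" "y \<notin> range xs" for y using that by (simp add: b_def)
  have tK: "twist_action \<Gamma> \<alpha> v b \<in> carrier K" using v bK by auto
  have "a y \<otimes> twist_action \<Gamma> \<alpha> v b y = b y" if y: "y \<in> dyadic" for y
  proof -
    define z where "z = hinv v y"
    have z: "z \<in> dyadic" "y = v z" using v y by (simp_all add: z_def)
    have tw: "twist_action \<Gamma> \<alpha> v b y = pw (- log2_slope v z) (b z)"
      using twist_apply_image[OF v z(1), of b] z by simp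
    show ?thesis
    proof (cases "z \<in> range xs")
      case True
      then obtain n where n: "z = xs n" by blast
      have "y = xs (Suc n)" using z n step by simp
      moreover have "xs (Suc n) \<noteq> xs 0" using inj by (auto dest: injD)
      moreover have "a (xs (Suc n)) = \<one>" using a xd \<open>xs (Suc n) \<noteq> xs 0\<close> by (simp add: trivial_off_def)
      ultimately show ?thesis using tw n bx cS cc by simp
    next
      case False
      then have tw1: "twist_action \<Gamma> \<alpha> v b y = \<one>" using tw b1 z by simp
      show ?thesis
      proof (cases "y \<in> range xs")
        case True
        then obtain n where n: "y = xs n" by blast
        have "n = 0"
        proof (rule ccontr)
          assume "n \<noteq> 0"
          then obtain m where "n = Suc m" by (cases n) auto
          then have "v z = v (xs m)" using n z step by simp
          then show False using False v by simp
        qed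
        then show ?thesis using n bx c0 tw1 aK xd by simp
      next
        case notin: False
        then have "y \<noteq> xs 0" by auto
        then have "a y = \<one>" using a y by (simp add: trivial_off_def)
        then show ?thesis using tw1 b1 y notin by simp
      qed
    qed
  qed
  then have "a \<otimes>\<^bsub>K\<^esub> twist_action \<Gamma> \<alpha> v b = b"
    by (intro K_eqI) (use aK bK tK in auto)
  then have "a = b \<otimes>\<^bsub>K\<^esub> inv\<^bsub>K\<^esub> (twist_action \<Gamma> \<alpha> v b)"
    using aK bK tK Kg.inv_solve_right by metis
  moreover have "trivial_off b (range xs)" using bK b1 by (auto simp: trivial_off_def)
  ultimately show ?thesis by blast
qed

text \<open>The commutator of \<open>w\<close> with any function is trivial off \<open>J\<close>,
  where \<open>v\<close> does nothing. No restriction on \<open>b\<close> enters, so the identity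
  can be transported along an isomorphism of the base groups.\<close>

lemma (in twisted) double_commutator_trivial:
  assumes v: "supported v I" and w: "supported w J" and IJ: "I \<inter> J = {}" and b: "b \<in> carrier K"
  shows "act (\<one>\<^bsub>K\<^esub>, v) (act (\<one>\<^bsub>K\<^esub>, w) b \<otimes>\<^bsub>K\<^esub> inv\<^bsub>K\<^esub> b) = act (\<one>\<^bsub>K\<^esub>, w) b \<otimes>\<^bsub>K\<^esub> inv\<^bsub>K\<^esub> b"
proof -
  have V: "v \<in> thompsonV_set" "w \<in> thompsonV_set" using v w by (simp_all add: supported_def)
  have t: "trivial_off (twist_action \<Gamma> \<alpha> w b \<otimes>\<^bsub>K\<^esub> inv\<^bsub>K\<^esub> b) J"
    by (rule trivial_off_commutator[OF w b])
  then have K: "twist_action \<Gamma> \<alpha> w b \<otimes>\<^bsub>K\<^esub> inv\<^bsub>K\<^esub> b \<in> carrier K" by (simp add: trivial_off_def)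
  show ?thesis
    using twist_disjoint[OF v t IJ] by (simp add: act_V[OF V(2) b] act_V[OF V(1) K])
qed

lemma (in twisted) V_embed [simp]: "v \<in> thompsonV_set \<Longrightarrow> (\<one>\<^bsub>K\<^esub>, v) \<in> carrier G"
  using group.is_monoid[OF K_group] by (simp add: carrier_G monoid.one_closed)

lemma (in twisted) V_embed_mult:
  "v \<in> thompsonV_set \<Longrightarrow> w \<in> thompsonV_set \<Longrightarrow> (\<one>\<^bsub>K\<^esub>, v) \<otimes>\<^bsub>G\<^esub> (\<one>\<^bsub>K\<^esub>, w) = (\<one>\<^bsub>K\<^esub>, v \<circ> w)"
  using group.is_monoid[OF K_group] by (simp add: G_mult twist_one monoid.l_one monoid.one_closed)

lemma (in twisted) K_embed_mult:
  "a \<in> carrier K \<Longrightarrow> b \<in> carrier K \<Longrightarrow> (a, id) \<otimes>\<^bsub>G\<^esub> (b, id) = (a \<otimes>\<^bsub>K\<^esub> b, id)"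
  by (simp add: G_mult twist_id)

lemma (in twisted) K_V_decompose:
  "a \<in> carrier K \<Longrightarrow> v \<in> thompsonV_set \<Longrightarrow> (a, id) \<otimes>\<^bsub>G\<^esub> (\<one>\<^bsub>K\<^esub>, v) = (a, v)"
  using group.is_monoid[OF K_group] by (simp add: G_mult twist_id monoid.r_one monoid.one_closed)

section \<open>What an isomorphism induces on \<open>K\<close> and on \<open>V\<close>\<close>

locale twisted_iso = A: twisted \<Gamma> \<alpha> + B: twisted \<Gamma>' \<alpha>'
  for \<Gamma> :: "('g, 'm) monoid_scheme" and \<alpha> and \<Gamma>' :: "('h, 'n) monoid_scheme" and \<alpha>' +
  fixes \<theta>
  assumes theta: "\<theta> \<in> iso A.G B.G"
begin

lemma theta_bij: "bij_betw \<theta> (carrier A.G) (carrier B.G)"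
  using theta by (simp add: iso_def)

lemma theta_closed [simp]: "X \<in> carrier A.G \<Longrightarrow> \<theta> X \<in> carrier B.G"
  using theta_bij bij_betwE by blast

lemma theta_mult: "X \<in> carrier A.G \<Longrightarrow> Y \<in> carrier A.G \<Longrightarrow> \<theta> (X \<otimes>\<^bsub>A.G\<^esub> Y) = \<theta> X \<otimes>\<^bsub>B.G\<^esub> \<theta> Y"
  using theta by (simp add: iso_def hom_mult)

lemma theta_eq_iff: "X \<in> carrier A.G \<Longrightarrow> Y \<in> carrier A.G \<Longrightarrow> \<theta> X = \<theta> Y \<longleftrightarrow> X = Y"
  by (rule inj_on_eq_iff[OF bij_betw_imp_inj_on[OF theta_bij]])

lemma theta_surj:
  assumes "Z \<in> carrier B.G" shows "\<exists>X\<in>carrier A.G. \<theta> X = Z"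
proof -
  have "Z \<in> \<theta> ` carrier A.G" unfolding bij_betw_imp_surj_on[OF theta_bij] by (rule assms)
  then show ?thesis by blast
qed

text \<open>Everything shown for \<open>\<theta>\<close> becomes available for its inverse;
  surjectivity statements are obtained in this way.\<close>

lemma theta_inv_iso: "twisted_iso \<Gamma>' \<alpha>' \<Gamma> \<alpha> (inv_into (carrier A.G) \<theta>)"
proof -
  have "inv_into (carrier A.G) \<theta> \<in> iso B.G A.G"
    using group.iso_set_sym[OF A.G_group theta] .
  then show ?thesis
    by (intro twisted_iso.intro twisted_iso_axioms.intro A.twisted_axioms B.twisted_axioms)
qed

lemma snd_theta_K: "a \<in> carrier A.K \<Longrightarrow> snd (\<theta> (a, id)) = id"
proof -
  assume a: "a \<in> carrier A.K"
  have h: "snd \<circ> \<theta> \<in> hom A.G thompsonV"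
    by (rule homI) (auto simp: theta_mult B.snd_mult B.carrier_G dest!: theta_closed)
  have "(snd \<circ> \<theta>) ` carrier A.G = thompsonV_set"
    unfolding image_comp[symmetric] bij_betw_imp_surj_on[OF theta_bij]
    using B.V_embed by (auto simp: B.carrier_G image_iff)
  then show ?thesis using A.tau_K_trivial[OF h _ a] by simp
qed

definition \<kappa> where "\<kappa> a = fst (\<theta> (a, id))"

definition \<psi> where "\<psi> v = snd (\<theta> (\<one>\<^bsub>A.K\<^esub>, v))"

text \<open>Both coordinates are kept: the image of \<open>v\<close> need not lie in the copy of
  \<open>V\<close>, and its \<open>K\<close>-part conjugates the values.\<close>

definition Y where "Y v = \<theta> (\<one>\<^bsub>A.K\<^esub>, v)"

lemma theta_K: "a \<in> carrier A.K \<Longrightarrow> \<theta> (a, id) = (\<kappa> a, id)"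
  using snd_theta_K by (metis \<kappa>_def prod.collapse)

lemma kappa_closed [simp]: "a \<in> carrier A.K \<Longrightarrow> \<kappa> a \<in> carrier B.K"
  using theta_closed[of "(a, id)"] theta_K by (simp add: A.carrier_G B.carrier_G)

lemma kappa_eq_iff: "a \<in> carrier A.K \<Longrightarrow> b \<in> carrier A.K \<Longrightarrow> \<kappa> a = \<kappa> b \<longleftrightarrow> a = b"
  using theta_eq_iff[of "(a, id)" "(b, id)"] theta_K by (simp add: A.carrier_G)

lemma kappa_hom: "\<kappa> \<in> hom A.K B.K"
proof (rule homI)
  fix a b assume ab: "a \<in> carrier A.K" "b \<in> carrier A.K"
  interpret KA: group A.K by (rule A.K_group)
  have "\<theta> ((a, id) \<otimes>\<^bsub>A.G\<^esub> (b, id)) = \<theta> (a, id) \<otimes>\<^bsub>B.G\<^esub> \<theta> (b, id)"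
    using ab by (intro theta_mult) (simp_all add: A.carrier_G)
  then show "\<kappa> (a \<otimes>\<^bsub>A.K\<^esub> b) = \<kappa> a \<otimes>\<^bsub>B.K\<^esub> \<kappa> b"
    using ab by (simp add: theta_K A.K_embed_mult B.K_embed_mult)
qed simp

lemma kappa_surj: "b \<in> carrier B.K \<Longrightarrow> \<exists>a\<in>carrier A.K. \<kappa> a = b"
proof -
  assume b: "b \<in> carrier B.K"
  interpret I: twisted_iso \<Gamma>' \<alpha>' \<Gamma> \<alpha> "inv_into (carrier A.G) \<theta>" by (rule theta_inv_iso)
  have bG: "(b, id) \<in> carrier B.G" using b by (simp add: B.carrier_G)
  have "\<theta> (I.\<kappa> b, id) = (b, id)"
    using I.theta_K[OF b] bij_betw_inv_into_right[OF theta_bij bG] by simp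
  then have "\<kappa> (I.\<kappa> b) = b" by (simp add: \<kappa>_def)
  then show ?thesis using I.kappa_closed[OF b] by blast
qed

lemma kappa_group_hom: "group_hom A.K B.K \<kappa>"
  using kappa_hom A.K_group B.K_group by (simp add: group_hom_def group_hom_axioms_def)

lemma kappa_act:
  assumes "X \<in> carrier A.G" "a \<in> carrier A.K"
  shows "\<kappa> (A.act X a) = B.act (\<theta> X) (\<kappa> a)"
proof -
  have 1: "(a, id) \<in> carrier A.G" "(A.act X a, id) \<in> carrier A.G"
    using assms by (auto simp: A.carrier_G)
  have "\<theta> X \<otimes>\<^bsub>B.G\<^esub> (\<kappa> a, id) = (\<kappa> (A.act X a), id) \<otimes>\<^bsub>B.G\<^esub> \<theta> X"
    using arg_cong[OF A.act_conj[OF assms], of \<theta>] assms 1 by (simp add: theta_mult theta_K A.act_closed)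
  then show ?thesis using B.act_unique[of "\<theta> X" "\<kappa> a" "\<kappa> (A.act X a)"] assms A.act_closed by simp
qed

lemma Y_closed [simp]: "v \<in> thompsonV_set \<Longrightarrow> Y v \<in> carrier B.G"
  by (simp add: Y_def)

lemma snd_Y [simp]: "snd (Y v) = \<psi> v"
  by (simp add: Y_def \<psi>_def)

lemma kappa_act_V: "v \<in> thompsonV_set \<Longrightarrow> a \<in> carrier A.K \<Longrightarrow> \<kappa> (A.act (\<one>\<^bsub>A.K\<^esub>, v) a) = B.act (Y v) (\<kappa> a)"
  unfolding Y_def by (rule kappa_act) auto

lemma psi_V [simp]: "v \<in> thompsonV_set \<Longrightarrow> \<psi> v \<in> thompsonV_set"
  using Y_closed[of v] snd_Y[of v] by (metis B.carrier_G mem_Times_iff)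

lemma psi_comp: "v \<in> thompsonV_set \<Longrightarrow> w \<in> thompsonV_set \<Longrightarrow> \<psi> (v \<circ> w) = \<psi> v \<circ> \<psi> w"
  unfolding \<psi>_def by (simp flip: A.V_embed_mult add: theta_mult B.snd_mult)

lemma psi_surj: "w \<in> thompsonV_set \<Longrightarrow> \<exists>v\<in>thompsonV_set. \<psi> v = w"
proof -
  assume w: "w \<in> thompsonV_set"
  obtain X where X: "X \<in> carrier A.G" "\<theta> X = (\<one>\<^bsub>B.K\<^esub>, w)" using theta_surj B.V_embed[OF w] by blast
  obtain a v where av: "X = (a, v)" "a \<in> carrier A.K" "v \<in> thompsonV_set" using X by (auto simp: A.carrier_G)
  have "\<theta> X = \<theta> (a, id) \<otimes>\<^bsub>B.G\<^esub> \<theta> (\<one>\<^bsub>A.K\<^esub>, v)"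
    unfolding av(1) A.K_V_decompose[OF av(2,3), symmetric]
    by (rule theta_mult[OF _ A.V_embed[OF av(3)]]) (use av in \<open>simp add: A.carrier_G\<close>)
  then have "w = \<psi> v" using X(2) snd_theta_K[OF av(2)] B.snd_mult by (metis \<psi>_def id_comp snd_conv)
  then show ?thesis using av by blast
qed

text \<open>If \<open>\<psi> v\<close> is the identity, \<open>Y v\<close> lies in the target base
  group, which is the image of the source one; injectivity of \<open>\<theta>\<close> then puts
  \<open>v\<close> into \<open>K\<close>.\<close>

lemma psi_id_iff: "v \<in> thompsonV_set \<Longrightarrow> \<psi> v = id \<longleftrightarrow> v = id"
proof
  assume v: "v \<in> thompsonV_set" and "\<psi> v = id"
  then have "Y v = (fst (Y v), id)" by (metis prod.collapse snd_Y)
  moreover have "fst (Y v) \<in> carrier B.K" using Y_closed[OF v] by (auto simp: B.carrier_G)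
  then obtain a where "a \<in> carrier A.K" "\<kappa> a = fst (Y v)" using kappa_surj by blast
  ultimately have "\<theta> (\<one>\<^bsub>A.K\<^esub>, v) = \<theta> (a, id)" using theta_K by (simp add: Y_def)
  then have "(\<one>\<^bsub>A.K\<^esub>, v) = (a, id)"
    using theta_eq_iff A.V_embed[OF v] \<open>a \<in> carrier A.K\<close> by (simp add: A.carrier_G)
  then show "v = id" by simp
next
  assume "v \<in> thompsonV_set" "v = id"
  interpret KA: group A.K by (rule A.K_group)
  show "\<psi> v = id" unfolding \<psi>_def \<open>v = id\<close> by (rule snd_theta_K) simp
qed

lemma psi_eq_iff:
  assumes "v \<in> thompsonV_set" "w \<in> thompsonV_set" shows "\<psi> v = \<psi> w \<longleftrightarrow> v = w"
proof
  assume eq: "\<psi> v = \<psi> w"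
  have "\<psi> (hinv v \<circ> w) = \<psi> (hinv v \<circ> v)" using assms eq by (simp add: psi_comp)
  also have "\<dots> = id" using assms psi_id_iff[OF V_id] by (simp add: V_inv_comp)
  finally have "hinv v \<circ> w = id" using assms psi_id_iff by simp
  then have "v (hinv v (w x)) = v x" for x by (metis comp_apply id_apply)
  then show "v = w" using assms by (auto simp: fun_eq_iff)
qed simp

end

section \<open>Locating the images of the factors\<close>

locale nontrivial_twisted_iso = twisted_iso +
  assumes nontrivial: "carrier \<Gamma>' \<noteq> {\<one>\<^bsub>\<Gamma>'\<^esub>}"
begin

lemma ex_nontrivial: "\<exists>g\<in>carrier \<Gamma>'. g \<noteq> \<one>\<^bsub>\<Gamma>'\<^esub>"
  using nontrivial B.one_closed by blast

text \<open>The commutator identity [V_I, [V_J, K]] = 1, applied to a function supported at one point.\<close>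
lemma psi_preserves_pair:
  assumes v: "supported v I" and w: "supported w J" and IJ: "I \<inter> J = {}"
    and y: "y \<in> dyadic" and move: "\<psi> w y \<noteq> y"
  shows "\<psi> v y \<in> {y, \<psi> w y}" and "\<psi> v (\<psi> w y) \<in> {y, \<psi> w y}"
proof -
  interpret KA: group A.K by (rule A.K_group)
  interpret KB: group B.K by (rule B.K_group)
  interpret k: group_hom A.K B.K \<kappa> by (rule kappa_group_hom)
  have V: "v \<in> thompsonV_set" "w \<in> thompsonV_set" using v w by (simp_all add: supported_def)
  obtain g where g: "g \<in> carrier \<Gamma>'" "g \<noteq> \<one>\<^bsub>\<Gamma>'\<^esub>" using ex_nontrivial by blast
  define a where "a = B.delta y g"
  have a: "a \<in> carrier B.K" using g by (simp add: a_def)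
  obtain b where b: "b \<in> carrier A.K" "\<kappa> b = a" using kappa_surj[OF a] by blast
  define D where "D = A.act (\<one>\<^bsub>A.K\<^esub>, w) b \<otimes>\<^bsub>A.K\<^esub> inv\<^bsub>A.K\<^esub> b"
  have DK: "D \<in> carrier A.K" using b V by (simp add: D_def A.act_closed)
  have D: "A.act (\<one>\<^bsub>A.K\<^esub>, v) D = D" unfolding D_def by (rule A.double_commutator_trivial[OF v w IJ b(1)])
  define d where "d = \<kappa> D"
  have dK: "d \<in> carrier B.K" using DK by (simp add: d_def)
  have d_eq: "d = B.act (Y w) a \<otimes>\<^bsub>B.K\<^esub> inv\<^bsub>B.K\<^esub> a"
    using b V by (simp add: d_def D_def A.act_closed kappa_act_V)
  have d_fix: "B.act (Y v) d = d" using kappa_act_V[OF V(1) DK] D by (simp add: d_def)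
  have aw: "B.act (Y w) a z = \<one>\<^bsub>\<Gamma>'\<^esub> \<longleftrightarrow> z \<noteq> \<psi> w y" if z: "z \<in> dyadic" for z
  proof -
    define z' where "z' = hinv (\<psi> w) z"
    have "z' \<in> dyadic" "z = \<psi> w z'" using V z by (simp_all add: z'_def)
    then show ?thesis using B.act_one_iff[of "Y w" a z'] V a g by (simp add: a_def)
  qed
  have awc: "B.act (Y w) a \<in> carrier B.K" using V a by (simp add: B.act_closed)
  \<comment> \<open>The two factors of \<open>d\<close> are nontrivial at one point each. The points
    differ by \<open>move\<close>, so no cancellation occurs.\<close>
  have supp: "d z \<noteq> \<one>\<^bsub>\<Gamma>'\<^esub> \<longleftrightarrow> z \<in> {y, \<psi> w y}" if z: "z \<in> dyadic" for z
  proof -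
    have dz: "d z = B.act (Y w) a z \<otimes>\<^bsub>\<Gamma>'\<^esub> inv\<^bsub>\<Gamma>'\<^esub> a z" using z a by (simp add: d_eq)
    have c: "B.act (Y w) a z \<in> carrier \<Gamma>'" using awc z by auto
    consider "z = y" | "z = \<psi> w y" "z \<noteq> y" | "z \<noteq> y" "z \<noteq> \<psi> w y" by blast
    then show ?thesis
    proof cases
      case 1
      then show ?thesis using dz aw[OF z] move z g by (simp add: a_def B.inv_eq_1_iff)
    next
      case 2
      then show ?thesis using dz aw[OF z] z g c by (simp add: a_def)
    next
      case 3
      then show ?thesis using dz aw[OF z] z by (simp add: a_def)
    qed
  qed
  have pres: "\<psi> v z \<in> {y, \<psi> w y}" if "z \<in> {y, \<psi> w y}" for z
  proof -
    have z: "z \<in> dyadic" using that y V by auto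
    then have "d (\<psi> v z) \<noteq> \<one>\<^bsub>\<Gamma>'\<^esub>"
      using B.act_fixed_moves[OF Y_closed[OF V(1)] dK d_fix z] supp[OF z] that by simp
    then show ?thesis using supp[of "\<psi> v z"] V z by simp
  qed
  show "\<psi> v y \<in> {y, \<psi> w y}" "\<psi> v (\<psi> w y) \<in> {y, \<psi> w y}" by (rule pres, simp)+
qed

text \<open>A swap is a product of two swaps of smaller cones that are conjugate inside the rigid
  stabilizer, so it acts trivially on any invariant pair of points.\<close>
lemma psi_fixes_of_swp_moves:
  assumes uw: "indep u w" and v: "supported v J" and J: "J \<inter> (cone u \<union> cone w) = {}"
    and y: "y \<in> dyadic" and move: "\<psi> (swp u w) y \<noteq> y"
  shows "\<psi> v y = y"
proof (rule ccontr)
  assume vy: "\<psi> v y \<noteq> y"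
  define z where "z = \<psi> v y"
  define s0 where "s0 = swp (u @ [False]) (w @ [False])"
  define s1 where "s1 = swp (u @ [True]) (w @ [True])"
  define t0 where "t0 = swp (u @ [False]) (u @ [True])"
  define t1 where "t1 = swp (w @ [False]) (w @ [True])"
  have i: "indep (u @ [a]) (w @ [b])" "indep (w @ [a]) (u @ [b])" for a b
    using uw indep_sym indep_appendI by blast+
  have dj: "pre u p \<notin> cone w" "pre w p \<notin> cone u" for p
    using uw pre_in_cone[of u p] pre_in_cone[of w p] unfolding indep_def by blast+
  have V: "s0 \<in> thompsonV_set" "s1 \<in> thompsonV_set" "t0 \<in> thompsonV_set" "t1 \<in> thompsonV_set"
    using i by (simp_all add: s0_def s1_def t0_def t1_def)
  have sub: "cone (u @ [a]) \<subseteq> cone u \<union> cone w" "cone (w @ [a]) \<subseteq> cone u \<union> cone w" for a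
    using cone_append_subset by blast+
  have supp0: "supported (swp p r) (cone u \<union> cone w)"
    if "indep p r" "cone p \<subseteq> cone u \<union> cone w" "cone r \<subseteq> cone u \<union> cone w" for p r
    using supported_mono[OF supported_swp[OF that(1)]] that by blast
  have supp: "supported s0 (cone u \<union> cone w)" "supported s1 (cone u \<union> cone w)"
    "supported t0 (cone u \<union> cone w)" "supported t1 (cone u \<union> cone w)"
    unfolding s0_def s1_def t0_def t1_def
    by (rule supp0; use i sub in simp)+
  have split: "(\<exists>p. x = pre (u @ [False]) p) \<or> (\<exists>p. x = pre (u @ [True]) p) \<or>
    (\<exists>p. x = pre (w @ [False]) p) \<or> (\<exists>p. x = pre (w @ [True]) p) \<or> (x \<notin> cone u \<and> x \<notin> cone w)" for x
  proof -
    have *: "\<exists>b q. p = pre [b] q" for p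
    proof -
      have "p \<in> cone [p 0]" by (simp add: cone_def)
      then show ?thesis using in_coneE by blast
    qed
    have "\<exists>b q. x = pre (r @ [b]) q" if "x \<in> cone r" for r
      using that * in_coneE pre_append by metis
    then show ?thesis by (metis (full_types))
  qed
  have out: "s0 x = x" "s1 x = x" "t0 x = x" "t1 x = x" "swp u w x = x" if "x \<notin> cone u" "x \<notin> cone w" for x
    unfolding s0_def s1_def t0_def t1_def using that cone_append_subset by (blast intro: swp_other)+
  have ev: "s0 (pre (u @ [False]) p) = pre (w @ [False]) p" "s0 (pre (w @ [False]) p) = pre (u @ [False]) p"
    "s0 (pre (u @ [True]) p) = pre (u @ [True]) p" "s0 (pre (w @ [True]) p) = pre (w @ [True]) p"
    "s1 (pre (u @ [True]) p) = pre (w @ [True]) p" "s1 (pre (w @ [True]) p) = pre (u @ [True]) p"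
    "s1 (pre (u @ [False]) p) = pre (u @ [False]) p" "s1 (pre (w @ [False]) p) = pre (w @ [False]) p"
    "t0 (pre (u @ [False]) p) = pre (u @ [True]) p" "t0 (pre (u @ [True]) p) = pre (u @ [False]) p"
    "t0 (pre (w @ [a]) p) = pre (w @ [a]) p"
    "t1 (pre (w @ [False]) p) = pre (w @ [True]) p" "t1 (pre (w @ [True]) p) = pre (w @ [False]) p"
    "t1 (pre (u @ [a]) p) = pre (u @ [a]) p"
    "swp u w (pre (u @ [a]) p) = pre (w @ [a]) p" "swp u w (pre (w @ [a]) p) = pre (u @ [a]) p" for p a
    unfolding s0_def s1_def t0_def t1_def
    using uw i by (simp_all add: swp_third) (simp_all add: pre_append)
  have prod: "swp u w = s0 \<circ> s1"
  proof
    fix x show "swp u w x = (s0 \<circ> s1) x" using split[of x] by (elim disjE exE conjE) (simp_all add: ev out)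
  qed
  have conj: "(t0 \<circ> t1) \<circ> s0 = s1 \<circ> (t0 \<circ> t1)"
  proof
    fix x show "((t0 \<circ> t1) \<circ> s0) x = (s1 \<circ> (t0 \<circ> t1)) x"
      using split[of x] by (elim disjE exE conjE) (simp_all add: ev out)
  qed
  \<comment> \<open>The roles are exchanged here: \<open>v\<close> is the moving element, so every
    \<open>f\<close> supported on the two cones preserves the pair \<open>y\<close>,
    \<open>z\<close>.\<close>
  have pair: "\<psi> f y \<in> {y, z}" "\<psi> f z \<in> {y, z}" "\<psi> f y \<noteq> \<psi> f z" if "supported f (cone u \<union> cone w)" for f
    using psi_preserves_pair[OF that v _ y vy] J that vy by (auto simp: z_def supported_def)
  have "supported (t0 \<circ> t1) (cone u \<union> cone w)" using supported_comp supp by blast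
  note pt = pair[OF this] and p0 = pair[OF supp(1)] and p1 = pair[OF supp(2)]
  have "\<psi> (t0 \<circ> t1) (\<psi> s0 x) = \<psi> s1 (\<psi> (t0 \<circ> t1) x)" for x
    using arg_cong[OF conj, of \<psi>] V by (simp add: psi_comp fun_eq_iff)
  \<comment> \<open>Permutations of a two-element set commute and square to the identity. Being
    conjugate within them, \<open>s0\<close> and \<open>s1\<close> act alike on the pair, so their
    product acts trivially.\<close>
  then have "\<psi> s0 (\<psi> s1 y) = y"
    using pt p0 p1 by (smt (verit) insertE singletonD)
  then show False using move V by (simp add: prod psi_comp)
qed

text \<open>With \<open>a\<close> written as \<open>b\<close> times the inverse of its translate by
  \<open>v\<close>, it suffices that \<open>Y v\<close> leaves the value \<open>h\<close> of
  \<open>\<kappa> b\<close> at \<open>y\<close> unchanged. It does: \<open>\<psi> v\<close> fixes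
  \<open>y\<close> with slope one, so only a conjugation remains, and \<open>h\<close> is
  central.\<close>

lemma kappa_trivial_of_swp_moves:
  assumes uw: "indep u w" and x: "x \<in> dyadic" "x \<notin> cone u" "x \<notin> cone w"
    and y: "y \<in> dyadic" and move: "\<psi> (swp u w) y \<noteq> y" and a: "A.trivial_off a {x}"
  shows "\<kappa> a y = \<one>\<^bsub>\<Gamma>'\<^esub>"
proof -
  interpret KA: group A.K by (rule A.K_group)
  interpret KB: group B.K by (rule B.K_group)
  interpret k: group_hom A.K B.K \<kappa> by (rule kappa_group_hom)
  define \<sigma> where "\<sigma> = swp u w"
  have sV: "\<sigma> \<in> thompsonV_set" using uw by (simp add: \<sigma>_def)
  have ssup: "supported \<sigma> (cone u \<union> cone w)" using uw by (simp add: \<sigma>_def supported_swp)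
  obtain N where N: "\<And>n. n \<ge> N \<Longrightarrow> pre (pfx x n) zeros = x" using dyadic_pre_zeros[OF x(1)] by metis
  define q where "q = pfx x (N + length u + length w)"
  have qx: "pre q zeros = x" using N by (simp add: q_def)
  have qd: "cone q \<inter> (cone u \<union> cone w) = {}"
  proof -
    have "x \<in> cone r" if z: "z \<in> cone q" "z \<in> cone r" and r: "length r \<le> length q" for r z
    proof -
      have "z i = x i" if "i < length q" for i using z(1) that by (simp add: cone_def q_def)
      then show ?thesis using z(2) r by (simp add: cone_def)
    qed
    moreover have "length u \<le> length q" "length w \<le> length q" by (simp_all add: q_def)
    ultimately show ?thesis using x by blast
  qed
  \<comment> \<open>Chosen so that \<open>s1 \<circ> s2\<close> inserts one letter
    \<open>True\<close> after \<open>q\<close> on the points \<open>xs n\<close>, giving a one-way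
    orbit that starts at \<open>x\<close>.\<close>
  define s1 where "s1 = swp (q @ [True, True]) (q @ [False])"
  define s2 where "s2 = swp (q @ [True]) (q @ [False])"
  define v where "v = s1 \<circ> s2"
  have V: "s1 \<in> thompsonV_set" "s2 \<in> thompsonV_set" by (simp_all add: s1_def s2_def)
  have vV: "v \<in> thompsonV_set" using V by (simp add: v_def)
  have sup: "supported s1 (cone q)" "supported s2 (cone q)"
    unfolding s1_def s2_def by (simp_all add: supported_swp_cone)
  have fix_y: "\<psi> s1 y = y" "\<psi> s2 y = y"
    using psi_fixes_of_swp_moves[OF uw _ qd y move] sup by blast+
  \<comment> \<open>At a fixed point of an involution the chain rule doubles the log slope to 0.
    This is why \<open>v\<close> is built from two swaps.\<close>
  have slope: "log2_slope (\<psi> s) y = 0" if s: "s \<in> thompsonV_set" "s \<circ> s = id" "\<psi> s y = y" for s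
  proof -
    have "\<psi> s \<circ> \<psi> s = id" using psi_comp[OF s(1,1)] s psi_id_iff[OF V_id] by simp
    then have "log2_slope (\<psi> s) y + log2_slope (\<psi> s) y = 0"
      using log2_slope_comp[of "\<psi> s" "\<psi> s" y] s by simp
    then show ?thesis by simp
  qed
  have "s1 \<circ> s1 = id" "s2 \<circ> s2 = id" unfolding s1_def s2_def by (simp_all add: swp_comp_swp)
  then have vs: "log2_slope (\<psi> v) y = 0"
    using slope V fix_y by (simp add: v_def psi_comp log2_slope_comp)
  have vy: "\<psi> v y = y" using V fix_y by (simp add: v_def psi_comp)
  define xs where "xs n = pre (q @ replicate n True) zeros" for n
  have xd: "xs n \<in> dyadic" for n by (simp add: xs_def)
  have x0: "xs 0 = x" by (simp add: xs_def qx)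
  have step: "v (xs n) = xs (Suc n)" for n
  proof (cases n)
    case 0
    have "xs 0 = pre (q @ [False]) zeros" by (simp add: xs_def pre_append)
    then have "s2 (xs 0) = pre (q @ [True]) zeros" by (simp add: s2_def)
    also have eq: "\<dots> = pre (q @ [True, False]) zeros"
      using pre_append[of "q @ [True]" "[False]" zeros] by simp
    finally have "v (xs 0) = pre (q @ [True, False]) zeros"
      by (simp add: v_def s1_def swp_third)
    then show ?thesis using eq by (simp add: 0 xs_def)
  next
    case (Suc m)
    have "xs n = pre (q @ [True]) (pre (replicate m True) zeros)"
      using pre_append[of "q @ [True]" "replicate m True" zeros] by (simp add: xs_def Suc)
    then have "v (xs n) = pre (q @ [True, True]) (pre (replicate m True) zeros)"
      by (simp add: v_def s1_def s2_def)
    then show ?thesis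
      using pre_append[of "q @ [True, True]" "replicate m True" zeros] by (simp add: xs_def Suc)
  qed
  have "inj xs"
  proof (rule linorder_injI)
    fix m n :: nat assume "m < n"
    then have "\<not> xs m (length q + m)" "xs n (length q + m)"
      by (simp_all add: xs_def pre_def zeros_def nth_append)
    then show "xs m \<noteq> xs n" by metis
  qed
  then obtain b where b: "A.trivial_off b (range xs)"
    and ab: "a = b \<otimes>\<^bsub>A.K\<^esub> inv\<^bsub>A.K\<^esub> (twist_action \<Gamma> \<alpha> v b)"
    using A.swindle[of v xs a] vV xd step a x0 by auto
  have "range xs \<subseteq> cone q" by (auto simp: xs_def pre_append)
  then have bq: "A.trivial_off b (cone q)" using b unfolding A.trivial_off_def by blast
  have bK: "b \<in> carrier A.K" using b by (simp add: A.trivial_off_def)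
  have kbK: "\<kappa> b \<in> carrier B.K" using bK by simp
  define h where "h = \<kappa> b y"
  have hc: "h \<in> carrier \<Gamma>'" using kbK y by (auto simp: h_def)
  have central: "g \<otimes>\<^bsub>\<Gamma>'\<^esub> h = h \<otimes>\<^bsub>\<Gamma>'\<^esub> g" if g: "g \<in> carrier \<Gamma>'" for g
  proof -
    have dK: "B.delta y g \<in> carrier B.K" using g by simp
    obtain e where e: "e \<in> carrier A.K" "\<kappa> e = B.delta y g" using kappa_surj[OF dK] by blast
    \<comment> \<open>\<open>\<kappa> e\<close> is nontrivial at most at \<open>y\<close>, so
      \<open>\<kappa> C\<close> is trivial at \<open>\<psi> \<sigma> y\<close>. As \<open>C\<close>
      lives on \<open>cone q\<close>, it is invariant under \<open>\<sigma>\<close>, and triviality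
      passes back to \<open>y\<close>, where the value is the commutator of \<open>g\<close> and
      \<open>h\<close>.\<close>
    define C where "C = KA.comm e b"
    have Cq: "A.trivial_off C (cone q)" unfolding C_def using A.trivial_off_comm(2)[OF bq e(1)] .
    have CK: "C \<in> carrier A.K" using Cq by (simp add: A.trivial_off_def)
    have "(cone u \<union> cone w) \<inter> cone q = {}" using qd by blast
    then have "A.act (\<one>\<^bsub>A.K\<^esub>, \<sigma>) C = C" using A.twist_disjoint[OF ssup Cq] A.act_V[OF sV CK] by simp
    then have fixC: "B.act (Y \<sigma>) (\<kappa> C) = \<kappa> C" using kappa_act_V[OF sV CK] by simp
    have kC: "\<kappa> C = KB.comm (B.delta y g) (\<kappa> b)" using k.hom_comm e bK by (simp add: C_def)
    have val: "\<kappa> C z = B.comm (B.delta y g z) (\<kappa> b z)" if "z \<in> dyadic" for z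
      using that dK kbK by (simp add: kC KB.comm_def B.comm_def)
    have sy: "\<psi> \<sigma> y \<in> dyadic" "\<psi> \<sigma> y \<noteq> y" using sV y move by (simp_all add: \<sigma>_def)
    have "\<kappa> C (\<psi> \<sigma> y) = \<one>\<^bsub>\<Gamma>'\<^esub>"
      using val[OF sy(1)] sy B.K_value[OF kbK sy(1)] by (simp add: B.comm_def)
    then have "\<kappa> C y = \<one>\<^bsub>\<Gamma>'\<^esub>"
      using B.act_fixed_moves[OF Y_closed[OF sV] kappa_closed[OF CK] fixC y] by simp
    then have "B.comm g h = \<one>\<^bsub>\<Gamma>'\<^esub>" using val[OF y] y by (simp add: h_def)
    then show ?thesis using B.comm_one_iff g hc by simp
  qed
  have tb: "twist_action \<Gamma> \<alpha> v b \<in> carrier A.K" using vV bK by auto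
  have "\<kappa> a = \<kappa> b \<otimes>\<^bsub>B.K\<^esub> inv\<^bsub>B.K\<^esub> (B.act (Y v) (\<kappa> b))"
    unfolding ab using k.hom_mult k.hom_inv bK tb kappa_act_V[OF vV bK] A.act_V[OF vV bK] by simp
  then have 1: "\<kappa> a y = h \<otimes>\<^bsub>\<Gamma>'\<^esub> inv\<^bsub>\<Gamma>'\<^esub> (B.act (Y v) (\<kappa> b) y)"
    using y vV kbK by (simp add: h_def B.act_closed)
  define c where "c = fst (Y v) y"
  have cc: "c \<in> carrier \<Gamma>'" using Y_closed[OF vV] y unfolding c_def by (auto simp: B.carrier_G)
  have "B.act (Y v) (\<kappa> b) y = c \<otimes>\<^bsub>\<Gamma>'\<^esub> h \<otimes>\<^bsub>\<Gamma>'\<^esub> inv\<^bsub>\<Gamma>'\<^esub> c"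
    using B.act_image[OF Y_closed[OF vV] kbK y] vy vs by (simp add: c_def h_def)
  also have "\<dots> = h" using central[OF cc] cc hc by (simp add: B.m_assoc)
  finally show ?thesis using 1 hc by simp
qed

text \<open>The coordinates reached by the image of the factor at \<open>x\<close>. For nontrivial
  groups this turns out to be the graph of a bijection.\<close>

definition R where "R x y \<longleftrightarrow> x \<in> dyadic \<and> y \<in> dyadic \<and> (\<exists>a. A.trivial_off a {x} \<and> \<kappa> a y \<noteq> \<one>\<^bsub>\<Gamma>'\<^esub>)"

lemma R_dyadic: "R x y \<Longrightarrow> x \<in> dyadic \<and> y \<in> dyadic"
  by (simp add: R_def)

lemma R_equivariant:
  assumes "R x y" and v: "v \<in> thompsonV_set" shows "R (v x) (\<psi> v y)"
proof -
  obtain a where a: "A.trivial_off a {x}" "\<kappa> a y \<noteq> \<one>\<^bsub>\<Gamma>'\<^esub>" and xy: "x \<in> dyadic" "y \<in> dyadic"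
    using assms by (auto simp: R_def)
  have aK: "a \<in> carrier A.K" using a by (simp add: A.trivial_off_def)
  have "A.trivial_off (A.act (\<one>\<^bsub>A.K\<^esub>, v) a) {v x}"
    using A.trivial_off_act[OF a(1) A.V_embed[OF v]] by simp
  moreover have "\<kappa> (A.act (\<one>\<^bsub>A.K\<^esub>, v) a) (\<psi> v y) \<noteq> \<one>\<^bsub>\<Gamma>'\<^esub>"
    using B.act_one_iff[OF Y_closed[OF v] kappa_closed[OF aK] xy(2)] a(2) kappa_act_V[OF v aK] by simp
  ultimately show ?thesis using xy v by (auto simp: R_def)
qed

lemma R_fixed:
  assumes "R x z" "indep u w" "x \<notin> cone u" "x \<notin> cone w" shows "\<psi> (swp u w) z = z"
  using assms kappa_trivial_of_swp_moves unfolding R_def by blast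

text \<open>A swap avoiding \<open>x\<close> has an image fixing \<open>z\<close>, yet it can carry
  \<open>x'\<close> to any other point; so \<open>z\<close> would be reached from every point, and
  by transitivity every point would be reached from \<open>zeros\<close>. A swap avoiding
  \<open>zeros\<close> would then act trivially, against faithfulness.\<close>

lemma R_disjoint:
  assumes "R x z" "R x' z" shows "x = x'"
proof (rule ccontr)
  assume ne: "x \<noteq> x'"
  have d: "x \<in> dyadic" "x' \<in> dyadic" "z \<in> dyadic" using assms R_dyadic by auto
  have all: "R t z" if t: "t \<in> dyadic" for t
  proof (cases "t = x \<or> t = x'")
    case False
    then obtain u w where uw: "indep u w" "x \<notin> cone u" "x \<notin> cone w" "swp u w x' = t"
      using swap_dyadic[OF d(2) t] ne by metis
    have "R (swp u w x') (\<psi> (swp u w) z)" by (rule R_equivariant[OF assms(2) swp_V[OF uw(1)]])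
    then show ?thesis using uw R_fixed[OF assms(1) uw(1-3)] by simp
  qed (use assms in auto)
  \<comment> \<open>Both cones start with \<open>True\<close>, so this swap avoids
    \<open>zeros\<close>.\<close>
  define s where "s = swp [True, False] [True, True]"
  have sV: "s \<in> thompsonV_set" by (simp add: s_def)
  have "\<psi> s z' = z'" if z': "z' \<in> dyadic" for z'
  proof -
    obtain w where w: "w \<in> thompsonV_set" "w z = z'" using V_transitive d z' by blast
    obtain v where v: "v \<in> thompsonV_set" "\<psi> v = w" using psi_surj w by blast
    have "R (hinv v zeros) z" using all v by simp
    from R_equivariant[OF this v(1)] have "R zeros z'" using v w by simp
    moreover have "zeros \<notin> cone (True # r)" for r
    proof
      assume "zeros \<in> cone (True # r)"
      then have "zeros 0 = True" by (auto simp: cone_def)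
      then show False by (simp add: zeros_def)
    qed
    ultimately show ?thesis unfolding s_def by (intro R_fixed) simp_all
  qed
  then have "s = id" using V_eq_idI[OF psi_V[OF sV]] psi_id_iff[OF sV] by simp
  moreover have "s (pre [True, False] zeros) \<noteq> pre [True, False] zeros"
    unfolding s_def by (rule swp_moves) auto
  ultimately show False by simp
qed

lemma psi_lift_swap:
  assumes "r \<in> dyadic" "q \<in> dyadic" "r \<noteq> q" "p \<noteq> r" "p \<noteq> q"
  obtains v where "v \<in> thompsonV_set" "\<psi> v p = p" "\<psi> v r = q"
proof -
  obtain u w where "indep u w" "p \<notin> cone u" "p \<notin> cone w" "swp u w r = q"
    using swap_dyadic[OF assms] by metis
  then have "swp u w \<in> thompsonV_set" "swp u w p = p" "swp u w r = q" by (simp_all add: swp_other)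
  then show ?thesis using psi_surj that by metis
qed

text \<open>Take \<open>y\<close> reached from another point \<open>x'\<close>, and \<open>v\<close>
  whose image fixes \<open>z\<close> and moves \<open>z'\<close> to \<open>y\<close>. Since
  \<open>z\<close> is reached from only one point, \<open>v\<close> fixes \<open>x\<close>; but then
  \<open>y\<close> is reached from both \<open>x\<close> and \<open>x'\<close>.\<close>

lemma R_unique:
  assumes source: "\<And>x. x \<in> dyadic \<Longrightarrow> \<exists>y. R x y" and "R x z" "R x z'" shows "z = z'"
proof (rule ccontr)
  assume ne: "z \<noteq> z'"
  define x' where "x' = (if x = zeros then pre [True] zeros else zeros)"
  have "pre [True] zeros \<noteq> zeros"
  proof
    assume "pre [True] zeros = zeros"
    then have "pre [True] zeros 0 = zeros 0" by simp
    then show False by (simp add: pre_def zeros_def)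
  qed
  then have x': "x' \<in> dyadic" "x' \<noteq> x" by (auto simp: x'_def)
  obtain y where y: "R x' y" using source x' by blast
  have "y \<noteq> z" "y \<noteq> z'" using R_disjoint y assms x' by blast+
  moreover have "z' \<in> dyadic" "y \<in> dyadic" using R_dyadic y assms by auto
  ultimately obtain v where v: "v \<in> thompsonV_set" "\<psi> v z = z" "\<psi> v z' = y"
    using psi_lift_swap[of z' y z] ne by metis
  have "R (v x) z" using R_equivariant[OF assms(2) v(1)] v by simp
  then have "v x = x" using R_disjoint assms(2) by blast
  then have "R x y" using R_equivariant[OF assms(3) v(1)] v by simp
  then show False using R_disjoint y x' by blast
qed

end

section \<open>The bijection of dyadic points and the isomorphisms between factors\<close>

locale nontrivial_source_iso = nontrivial_twisted_iso +
  assumes nontrivial_source: "carrier \<Gamma> \<noteq> {\<one>\<^bsub>\<Gamma>\<^esub>}"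
begin

lemma R_ex: "x \<in> dyadic \<Longrightarrow> \<exists>y. R x y"
proof -
  assume x: "x \<in> dyadic"
  interpret k: group_hom A.K B.K \<kappa> by (rule kappa_group_hom)
  obtain g where g: "g \<in> carrier \<Gamma>" "g \<noteq> \<one>\<^bsub>\<Gamma>\<^esub>" using nontrivial_source A.one_closed by blast
  have d: "A.delta x g \<in> carrier A.K" using g by simp
  have "A.delta x g \<noteq> \<one>\<^bsub>A.K\<^esub>"
  proof
    assume "A.delta x g = \<one>\<^bsub>A.K\<^esub>"
    then have "A.delta x g x = \<one>\<^bsub>A.K\<^esub> x" by simp
    then show False using x g by simp
  qed
  then have "\<kappa> (A.delta x g) \<noteq> \<one>\<^bsub>B.K\<^esub>"
    using kappa_eq_iff[OF d k.G.one_closed] k.hom_one by metis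
  then obtain y where "y \<in> dyadic" "\<kappa> (A.delta x g) y \<noteq> \<one>\<^bsub>\<Gamma>'\<^esub>"
    using B.K_eqI[OF kappa_closed[OF d] k.H.one_closed] by auto
  then show ?thesis using x A.trivial_off_delta[OF g(1)] by (auto simp: R_def)
qed

definition \<phi> where "\<phi> x = (THE y. R x y)"

lemma R_iff: "x \<in> dyadic \<Longrightarrow> R x y \<longleftrightarrow> y = \<phi> x"
  unfolding \<phi>_def using R_ex R_unique[OF R_ex] by (metis the_equality)

lemma R_phi: "x \<in> dyadic \<Longrightarrow> R x (\<phi> x)"
  by (simp add: R_iff)

lemma phi_equivariant: "v \<in> thompsonV_set \<Longrightarrow> x \<in> dyadic \<Longrightarrow> \<phi> (v x) = \<psi> v (\<phi> x)"
  using R_equivariant[OF R_phi, of x v] R_iff[of "v x"] by simp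

lemma phi_dyadic [simp]: "x \<in> dyadic \<Longrightarrow> \<phi> x \<in> dyadic"
  using R_phi R_dyadic by blast

lemma phi_inj: "x \<in> dyadic \<Longrightarrow> x' \<in> dyadic \<Longrightarrow> \<phi> x = \<phi> x' \<Longrightarrow> x = x'"
  using R_phi R_disjoint by metis

lemma phi_surj: "y \<in> dyadic \<Longrightarrow> \<exists>x\<in>dyadic. \<phi> x = y"
proof -
  assume y: "y \<in> dyadic"
  obtain w where w: "w \<in> thompsonV_set" "w (\<phi> zeros) = y" using V_transitive y phi_dyadic zeros_dyadic by blast
  obtain v where v: "v \<in> thompsonV_set" "\<psi> v = w" using psi_surj w by blast
  have "\<phi> (v zeros) = y" using phi_equivariant[OF v(1) zeros_dyadic] v w by simp
  then show ?thesis using v by (intro bexI[of _ "v zeros"]) simp_all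
qed

lemma equivariant_bijection: "equivariant_bijection \<psi> \<phi>"
proof
  show "bij_betw \<psi> thompsonV_set thompsonV_set"
    unfolding bij_betw_def using psi_eq_iff psi_surj by (auto simp: inj_on_def image_iff) metis
  show "bij_betw \<phi> dyadic dyadic"
    unfolding bij_betw_def using phi_inj phi_surj by (auto simp: inj_on_def image_iff) metis
qed (simp_all add: psi_comp phi_equivariant)

definition \<beta> where "\<beta> x g = \<kappa> (A.delta x g) (\<phi> x)"

lemma beta_closed [simp]: "x \<in> dyadic \<Longrightarrow> g \<in> carrier \<Gamma> \<Longrightarrow> \<beta> x g \<in> carrier \<Gamma>'"
  unfolding \<beta>_def by (rule B.K_value) simp_all

lemma kappa_delta:
  assumes x: "x \<in> dyadic" and g: "g \<in> carrier \<Gamma>"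
  shows "\<kappa> (A.delta x g) = B.delta (\<phi> x) (\<beta> x g)"
proof (rule B.K_eqI)
  fix y assume y: "y \<in> dyadic"
  have "\<kappa> (A.delta x g) y = \<one>\<^bsub>\<Gamma>'\<^esub>" if "y \<noteq> \<phi> x"
    using that R_iff[OF x, of y] x y A.trivial_off_delta[OF g] unfolding R_def by blast
  then show "\<kappa> (A.delta x g) y = B.delta (\<phi> x) (\<beta> x g) y" using y by (simp add: \<beta>_def)
qed (use assms in simp_all)

end

text \<open>The inverse isomorphism sends the factor at \<open>\<phi> x\<close> into some factor, which must be the one at \<open>x\<close>;
  this gives surjectivity of the maps between factors.\<close>
lemma (in nontrivial_source_iso) beta_iso:
  assumes x: "x \<in> dyadic" shows "\<beta> x \<in> iso \<Gamma> \<Gamma>'"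
proof (rule isoI)
  interpret k: group_hom A.K B.K \<kappa> by (rule kappa_group_hom)
  show "\<beta> x \<in> hom \<Gamma> \<Gamma>'"
  proof (rule homI)
    fix g h assume gh: "g \<in> carrier \<Gamma>" "h \<in> carrier \<Gamma>"
    have "A.delta x (g \<otimes>\<^bsub>\<Gamma>\<^esub> h) = A.delta x g \<otimes>\<^bsub>A.K\<^esub> A.delta x h"
      by (rule A.K_eqI) (use gh in \<open>auto intro: k.G.m_closed\<close>)
    then show "\<beta> x (g \<otimes>\<^bsub>\<Gamma>\<^esub> h) = \<beta> x g \<otimes>\<^bsub>\<Gamma>'\<^esub> \<beta> x h"
      using gh x by (simp add: \<beta>_def)
  qed (use x in simp)
  have inj: "inj_on (\<beta> x) (carrier \<Gamma>)"
  proof (rule inj_onI)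
    fix g h assume gh: "g \<in> carrier \<Gamma>" "h \<in> carrier \<Gamma>" "\<beta> x g = \<beta> x h"
    then have "\<kappa> (A.delta x g) = \<kappa> (A.delta x h)" using kappa_delta x by simp
    then have "A.delta x g = A.delta x h" using kappa_eq_iff gh by simp
    then have "A.delta x g x = A.delta x h x" by simp
    then show "g = h" using x by simp
  qed
  have surj: "\<exists>g\<in>carrier \<Gamma>. \<beta> x g = g'" if g': "g' \<in> carrier \<Gamma>'" for g'
  proof (cases "g' = \<one>\<^bsub>\<Gamma>'\<^esub>")
    case True
    have "A.delta x \<one>\<^bsub>\<Gamma>\<^esub> = \<one>\<^bsub>A.K\<^esub>" by (rule A.K_eqI) auto
    then have "\<beta> x \<one>\<^bsub>\<Gamma>\<^esub> = g'" using True x by (simp add: \<beta>_def)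
    then show ?thesis by blast
  next
    case False
    interpret I: twisted_iso \<Gamma>' \<alpha>' \<Gamma> \<alpha> "inv_into (carrier A.G) \<theta>" by (rule theta_inv_iso)
    interpret I: nontrivial_source_iso \<Gamma>' \<alpha>' \<Gamma> \<alpha> "inv_into (carrier A.G) \<theta>"
      by unfold_locales (rule nontrivial_source, rule nontrivial)
    define g where "g = I.\<beta> (\<phi> x) g'"
    define x' where "x' = I.\<phi> (\<phi> x)"
    have g: "g \<in> carrier \<Gamma>" and x': "x' \<in> dyadic" using g' x by (simp_all add: g_def x'_def)
    have d: "B.delta (\<phi> x) g' \<in> carrier B.K" using g' by simp
    have "I.\<kappa> (B.delta (\<phi> x) g') = A.delta x' g" using I.kappa_delta[of "\<phi> x" g'] g' x by (simp add: g_def x'_def)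
    then have "inv_into (carrier A.G) \<theta> (B.delta (\<phi> x) g', id) = (A.delta x' g, id)"
      using I.theta_K[OF d] by simp
    moreover have "(B.delta (\<phi> x) g', id) \<in> carrier B.G" using d by (simp add: B.carrier_G)
    ultimately have "\<theta> (A.delta x' g, id) = (B.delta (\<phi> x) g', id)"
      using bij_betw_inv_into_right[OF theta_bij] by metis
    then have "\<kappa> (A.delta x' g) = B.delta (\<phi> x) g'" by (simp add: \<kappa>_def)
    then have eq: "B.delta (\<phi> x') (\<beta> x' g) = B.delta (\<phi> x) g'" using kappa_delta[OF x' g] by simp
    have "B.delta (\<phi> x') (\<beta> x' g) (\<phi> x) = g'" using eq x by simp
    \<comment> \<open>A function \<open>B.delta\<close> reveals its base point only if its value is
      nontrivial, whence the case distinction on \<open>g'\<close>.\<close>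
    then have "\<phi> x = \<phi> x'" "\<beta> x' g = g'" using False x by (auto split: if_splits)
    then have "\<beta> x g = g'" using phi_inj[OF x x'] by simp
    then show ?thesis using g by blast
  qed
  show "bij_betw (\<beta> x) (carrier \<Gamma>) (carrier \<Gamma>')"
    unfolding bij_betw_def using inj surj x by (auto simp: image_iff)
qed

text \<open>The contraction fixes \<open>zeros\<close> and its image fixes
  \<open>\<phi> zeros\<close>, so it acts on both factors. It acts by \<open>\<alpha>\<close> on the
  first and, its image having log slope -1, by \<open>\<alpha>'\<close> followed by conjugation with
  a value of the \<open>K\<close>-part on the second.\<close>

lemma (in nontrivial_source_iso) beta_conjugates:
  shows "\<exists>c\<in>carrier \<Gamma>'. \<forall>g\<in>carrier \<Gamma>.
    \<beta> zeros (\<alpha> g) = c \<otimes>\<^bsub>\<Gamma>'\<^esub> \<alpha>' (\<beta> zeros g) \<otimes>\<^bsub>\<Gamma>'\<^esub> inv\<^bsub>\<Gamma>'\<^esub> c"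
proof
  interpret eb: equivariant_bijection \<psi> \<phi> by (rule equivariant_bijection)
  define c where "c = fst (Y contraction) (\<phi> zeros)"
  show "c \<in> carrier \<Gamma>'"
    using Y_closed[OF contraction_V] phi_dyadic[OF zeros_dyadic] unfolding c_def by (auto simp: B.carrier_G)
  show "\<forall>g\<in>carrier \<Gamma>. \<beta> zeros (\<alpha> g) = c \<otimes>\<^bsub>\<Gamma>'\<^esub> \<alpha>' (\<beta> zeros g) \<otimes>\<^bsub>\<Gamma>'\<^esub> inv\<^bsub>\<Gamma>'\<^esub> c"
  proof
    fix g assume g: "g \<in> carrier \<Gamma>"
    have ag: "\<alpha> g \<in> carrier \<Gamma>" using A.pw_closed[OF g, of 1] by simp
    have dK: "A.delta zeros g \<in> carrier A.K" using g by simp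
    have "A.act (\<one>\<^bsub>A.K\<^esub>, contraction) (A.delta zeros g) = A.delta zeros (\<alpha> g)"
    proof -
      have "twist_action \<Gamma> \<alpha> contraction (A.delta zeros g) = A.delta zeros (\<alpha> g)"
      proof (rule A.K_eqI)
        fix y assume y: "y \<in> dyadic"
        define z where "z = hinv contraction y"
        have z: "z \<in> dyadic" "y = contraction z" using y by (simp_all add: z_def)
        then have "y = zeros \<longleftrightarrow> z = zeros"
          using V_eq_iff[OF contraction_V, of z zeros] by simp
        then show "twist_action \<Gamma> \<alpha> contraction (A.delta zeros g) y = A.delta zeros (\<alpha> g) y"
          using A.twist_apply_image[OF contraction_V z(1), of "A.delta zeros g"] z by simp
      qed (use g ag in auto)
      then show ?thesis using A.act_V[OF contraction_V dK] by simp
    qed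
    then have "\<kappa> (A.delta zeros (\<alpha> g)) = B.act (Y contraction) (\<kappa> (A.delta zeros g))"
      using kappa_act_V[OF contraction_V dK] by simp
    then have "\<beta> zeros (\<alpha> g) = B.act (Y contraction) (\<kappa> (A.delta zeros g)) (\<phi> zeros)"
      by (simp add: \<beta>_def)
    moreover have "\<psi> contraction (\<phi> zeros) = \<phi> zeros"
      using phi_equivariant[OF contraction_V zeros_dyadic] by simp
    ultimately show "\<beta> zeros (\<alpha> g) = c \<otimes>\<^bsub>\<Gamma>'\<^esub> \<alpha>' (\<beta> zeros g) \<otimes>\<^bsub>\<Gamma>'\<^esub> inv\<^bsub>\<Gamma>'\<^esub> c"
      using B.act_image[OF Y_closed[OF contraction_V] kappa_closed[OF dK] phi_dyadic[OF zeros_dyadic]]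
        eb.psi_contraction_slope
      by (simp add: c_def \<beta>_def)
  qed
qed

section \<open>The case of trivial groups and the conclusion\<close>

lemma (in twisted_iso) trivial_transfer:
  assumes "carrier \<Gamma> = {\<one>\<^bsub>\<Gamma>\<^esub>}" shows "carrier \<Gamma>' = {\<one>\<^bsub>\<Gamma>'\<^esub>}"
proof -
  interpret k: group_hom A.K B.K \<kappa> by (rule kappa_group_hom)
  have "g = \<one>\<^bsub>\<Gamma>'\<^esub>" if g: "g \<in> carrier \<Gamma>'" for g
  proof -
    obtain a where a: "a \<in> carrier A.K" "\<kappa> a = B.delta zeros g" using kappa_surj B.delta_closed[OF g] by blast
    have "a = \<one>\<^bsub>A.K\<^esub>" by (rule A.K_eqI) (use a A.K_value[OF a(1)] assms in auto)
    then have "B.delta zeros g zeros = \<one>\<^bsub>B.K\<^esub> zeros" using a by simp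
    then show ?thesis by simp
  qed
  then show ?thesis by blast
qed

text \<open>If \<open>\<Gamma>\<close> is trivial, so is \<open>\<Gamma>'\<close>, and the constant
  map serves. Otherwise \<open>trivial_transfer\<close> for the inverse isomorphism makes both
  groups nontrivial, and the factor at \<open>zeros\<close> gives the answer.\<close>

lemma (in twisted_iso) ex_conjugating_iso:
  shows "\<exists>b\<in>iso \<Gamma> \<Gamma>'. \<exists>c\<in>carrier \<Gamma>'. \<forall>g\<in>carrier \<Gamma>.
    b (\<alpha> g) = c \<otimes>\<^bsub>\<Gamma>'\<^esub> \<alpha>' (b g) \<otimes>\<^bsub>\<Gamma>'\<^esub> inv\<^bsub>\<Gamma>'\<^esub> c"
proof (cases "carrier \<Gamma> = {\<one>\<^bsub>\<Gamma>\<^esub>}")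
  case True
  have 1: "carrier \<Gamma>' = {\<one>\<^bsub>\<Gamma>'\<^esub>}" by (rule trivial_transfer[OF True])
  have "(\<lambda>_. \<one>\<^bsub>\<Gamma>'\<^esub>) \<in> iso \<Gamma> \<Gamma>'"
    by (rule isoI) (auto simp: hom_def True 1 bij_betw_def)
  moreover have "\<alpha>' \<one>\<^bsub>\<Gamma>'\<^esub> = \<one>\<^bsub>\<Gamma>'\<^esub>" using B.pw_one[of 1] by simp
  ultimately show ?thesis by (intro bexI[of _ "\<lambda>_. \<one>\<^bsub>\<Gamma>'\<^esub>"] bexI[of _ "\<one>\<^bsub>\<Gamma>'\<^esub>"]) auto
next
  case False
  interpret I: twisted_iso \<Gamma>' \<alpha>' \<Gamma> \<alpha> "inv_into (carrier A.G) \<theta>" by (rule theta_inv_iso)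
  have "carrier \<Gamma>' \<noteq> {\<one>\<^bsub>\<Gamma>'\<^esub>}" using I.trivial_transfer False by blast
  then interpret N: nontrivial_source_iso \<Gamma> \<alpha> \<Gamma>' \<alpha>' \<theta>
    using False by unfold_locales
  show ?thesis using N.beta_iso[OF zeros_dyadic] N.beta_conjugates by blast
qed

theorem mainTheorem1:
  fixes \<Gamma> :: "'g monoid" and \<Gamma>' :: "'h monoid"
    and \<alpha> :: "'g \<Rightarrow> 'g" and \<alpha>' :: "'h \<Rightarrow> 'h"
  assumes "group \<Gamma>" and "group \<Gamma>'"
    and "\<alpha> \<in> iso \<Gamma> \<Gamma>" and "\<alpha>' \<in> iso \<Gamma>' \<Gamma>'"
  shows "G_alpha \<Gamma> \<alpha> \<cong> G_alpha \<Gamma>' \<alpha>' \<longleftrightarrow>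
    (\<exists>\<beta> \<in> iso \<Gamma> \<Gamma>'. \<exists>h \<in> carrier \<Gamma>'. \<forall>y \<in> carrier \<Gamma>'.
       \<alpha>' y = h \<otimes>\<^bsub>\<Gamma>'\<^esub> \<beta> (\<alpha> (inv_into (carrier \<Gamma>) \<beta> y)) \<otimes>\<^bsub>\<Gamma>'\<^esub> inv\<^bsub>\<Gamma>'\<^esub> h)"
proof
  interpret A: twisted \<Gamma> \<alpha> using assms by (simp add: twisted_def twisted_axioms_def)
  interpret B: twisted \<Gamma>' \<alpha>' using assms by (simp add: twisted_def twisted_axioms_def)
  have \<alpha>c: "\<alpha> g \<in> carrier \<Gamma>" if "g \<in> carrier \<Gamma>" for g using A.pw_closed[OF that, of 1] by simp
  have \<alpha>c': "\<alpha>' g \<in> carrier \<Gamma>'" if "g \<in> carrier \<Gamma>'" for g using B.pw_closed[OF that, of 1] by simp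
  {
    assume "G_alpha \<Gamma> \<alpha> \<cong> G_alpha \<Gamma>' \<alpha>'"
    then obtain \<theta> where "\<theta> \<in> iso (G_alpha \<Gamma> \<alpha>) (G_alpha \<Gamma>' \<alpha>')" by (auto simp: is_iso_def)
    then interpret twisted_iso \<Gamma> \<alpha> \<Gamma>' \<alpha>' \<theta>
      by (intro twisted_iso.intro twisted_iso_axioms.intro A.twisted_axioms B.twisted_axioms)
    obtain b c where b: "b \<in> iso \<Gamma> \<Gamma>'" and c: "c \<in> carrier \<Gamma>'"
      and eq: "\<And>g. g \<in> carrier \<Gamma> \<Longrightarrow> b (\<alpha> g) = c \<otimes>\<^bsub>\<Gamma>'\<^esub> \<alpha>' (b g) \<otimes>\<^bsub>\<Gamma>'\<^esub> inv\<^bsub>\<Gamma>'\<^esub> c"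
      using ex_conjugating_iso by blast
    have bb: "bij_betw b (carrier \<Gamma>) (carrier \<Gamma>')" using b by (simp add: iso_def)
    \<comment> \<open>The relation at hand expresses the conjugate of \<open>\<alpha>\<close>
      through \<open>\<alpha>'\<close>; solving it for \<open>\<alpha>'\<close> makes the inverse of
      \<open>c\<close> the required witness.\<close>
    have "\<alpha>' y = inv\<^bsub>\<Gamma>'\<^esub> c \<otimes>\<^bsub>\<Gamma>'\<^esub> b (\<alpha> (inv_into (carrier \<Gamma>) b y)) \<otimes>\<^bsub>\<Gamma>'\<^esub> inv\<^bsub>\<Gamma>'\<^esub> (inv\<^bsub>\<Gamma>'\<^esub> c)"
      if y: "y \<in> carrier \<Gamma>'" for y
    proof -
      define g where "g = inv_into (carrier \<Gamma>) b y"
      have g: "g \<in> carrier \<Gamma>" "b g = y"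
        using bb y by (auto simp: g_def bij_betw_inv_into_right bij_betw_def inv_into_into)
      have "inv\<^bsub>\<Gamma>'\<^esub> c \<otimes>\<^bsub>\<Gamma>'\<^esub> (c \<otimes>\<^bsub>\<Gamma>'\<^esub> \<alpha>' y) = \<alpha>' y"
        using c \<alpha>c'[OF y] by (simp flip: B.m_assoc)
      then show ?thesis
        unfolding g_def[symmetric] using eq[OF g(1)] g c \<alpha>c'[OF y] by (simp add: B.m_assoc)
    qed
    then show "\<exists>\<beta> \<in> iso \<Gamma> \<Gamma>'. \<exists>h \<in> carrier \<Gamma>'. \<forall>y \<in> carrier \<Gamma>'.
       \<alpha>' y = h \<otimes>\<^bsub>\<Gamma>'\<^esub> \<beta> (\<alpha> (inv_into (carrier \<Gamma>) \<beta> y)) \<otimes>\<^bsub>\<Gamma>'\<^esub> inv\<^bsub>\<Gamma>'\<^esub> h"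
      using b c B.inv_closed by blast
  next
    assume "\<exists>\<beta> \<in> iso \<Gamma> \<Gamma>'. \<exists>h \<in> carrier \<Gamma>'. \<forall>y \<in> carrier \<Gamma>'.
       \<alpha>' y = h \<otimes>\<^bsub>\<Gamma>'\<^esub> \<beta> (\<alpha> (inv_into (carrier \<Gamma>) \<beta> y)) \<otimes>\<^bsub>\<Gamma>'\<^esub> inv\<^bsub>\<Gamma>'\<^esub> h"
    then obtain b h where b: "b \<in> iso \<Gamma> \<Gamma>'" and h: "h \<in> carrier \<Gamma>'"
      and eq: "\<And>y. y \<in> carrier \<Gamma>' \<Longrightarrow>
        \<alpha>' y = h \<otimes>\<^bsub>\<Gamma>'\<^esub> b (\<alpha> (inv_into (carrier \<Gamma>) b y)) \<otimes>\<^bsub>\<Gamma>'\<^esub> inv\<^bsub>\<Gamma>'\<^esub> h" by blast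
    have bb: "bij_betw b (carrier \<Gamma>) (carrier \<Gamma>')" using b by (simp add: iso_def)
    have bc: "b g \<in> carrier \<Gamma>'" if "g \<in> carrier \<Gamma>" for g using bb that bij_betwE by blast
    show "G_alpha \<Gamma> \<alpha> \<cong> G_alpha \<Gamma>' \<alpha>'"
    proof (rule G_alpha_iso_of_conjugate[OF A.twisted_axioms B.twisted_axioms b])
      show "inv\<^bsub>\<Gamma>'\<^esub> h \<in> carrier \<Gamma>'" using h by simp
      fix g assume g: "g \<in> carrier \<Gamma>"
      have "\<alpha>' (b g) = h \<otimes>\<^bsub>\<Gamma>'\<^esub> b (\<alpha> g) \<otimes>\<^bsub>\<Gamma>'\<^esub> inv\<^bsub>\<Gamma>'\<^esub> h"
        using eq[OF bc[OF g]] bij_betw_inv_into_left[OF bb g] by simp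
      then show "b (\<alpha> g) \<otimes>\<^bsub>\<Gamma>'\<^esub> inv\<^bsub>\<Gamma>'\<^esub> h = inv\<^bsub>\<Gamma>'\<^esub> h \<otimes>\<^bsub>\<Gamma>'\<^esub> \<alpha>' (b g)"
        using h bc[OF \<alpha>c[OF g]] by (simp flip: B.m_assoc)
    qed
  }
qed

end
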